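(* Let $s>0$, let $E=\mathbb{R}^d$ be equipped with the standard Euclidean norm, and let $X\sim\mathcal{N}(\theta;\sigma^2I_d)$, $\theta\in\mathbb{R}^d$, for some $\sigma^2>0$; that is, $X=\theta+\xi$ with $\xi\sim\mathcal{N}(0;\Sigma)$, $\Sigma=\sigma^2I_d$ (so that $\|\Sigma\|=\sigma^2$ and $\mathbb{E}\|\xi\|^2=\sigma^2d$). Then $$\sup_{\|f\|_{C^s}\le1}\ \inf_T\ \sup_{\|\theta\|\le1}\mathbb{E}_\theta(T(X)-f(\theta))^2\ \ge\ c\Bigl(\bigl(\|\Sigma\|\vee(\mathbb{E}\|\xi\|^2)^s\bigr)\wedge1\Bigr),$$ where $c>0$ is a numerical constant, the outer supremum is over functions $f:\mathbb{R}^d\to\mathbb{R}$ with $\|f\|_{C^s}\le 1$, and the infimum is over all possible estimators $T(X)$.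
   Context: $a\vee b=\max(a,b)$, $a\wedge b=\min(a,b)$; $\mathbb{E}_\theta$ is expectation when $X\sim\mathcal{N}(\theta;\sigma^2I_d)$. An estimator $T(X)$ is a real-valued measurable function of $X$. The norm $\|f\|_{C^s}$: $f^{(j)}(x)$ denotes the $j$-th Fréchet derivative of $f:\mathbb{R}^d\to\mathbb{R}$ at $x$, a symmetric $j$-linear form, with operator norm $\|M\|=\sup_{\|h_1\|\le1,\dots,\|h_j\|\le1}|M(h_1,\dots,h_j)|$ (Euclidean norms); $f^{(0)}=f$. If $s$ is an integer, $\|f\|_{C^s}:=\max_{0\le j\le s}\sup_x\|f^{(j)}(x)\|$ for $s$ times differentiable $f$. If $s=m+\rho$ with integer $m\ge0$ and $\rho\in(0,1)$, $$\|f\|_{C^s}:=\max_{0\le j\le m}\sup_x\|f^{(j)}(x)\|\ \vee\ \sup_{x'\ne x''}\frac{\|f^{(m)}(x')-f^{(m)}(x'')\|}{\|x'-x''\|^\rho}$$ for $m$ times differentiable $f$.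
   Formalization: The numerical constant c is allowed to depend on s (but not on d or σ); a constant independent of s is impossible, as the case σ² = 1/d with s → ∞ and then d → ∞ shows. *)

theory Defs
  imports "HOL-Probability.Probability"
begin

(* The constant in the lower bound has to be uniform in the dimension d, so d is a natural number
   rather than a type.  Points of R^d are functions on {..<d}, extended by undefined outside
   {..<d} as in the library's product measures, and only values on euc d are ever used. *)

type_synonym pnt = "nat \<Rightarrow> real"

definition euc :: "nat \<Rightarrow> pnt set" where
  "euc d = {..<d} \<rightarrow>\<^sub>E UNIV"

definition vadd :: "nat \<Rightarrow> pnt \<Rightarrow> pnt \<Rightarrow> pnt" where
  "vadd d x y = (\<lambda>i\<in>{..<d}. x i + y i)"

definition vdiff :: "nat \<Rightarrow> pnt \<Rightarrow> pnt \<Rightarrow> pnt" where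
  "vdiff d x y = (\<lambda>i\<in>{..<d}. x i - y i)"

definition vscale :: "nat \<Rightarrow> real \<Rightarrow> pnt \<Rightarrow> pnt" where
  "vscale d a x = (\<lambda>i\<in>{..<d}. a * x i)"

definition vzero :: "nat \<Rightarrow> pnt" where
  "vzero d = (\<lambda>i\<in>{..<d}. 0)"

definition vnorm :: "nat \<Rightarrow> pnt \<Rightarrow> real" where
  "vnorm d x = L2_set x {..<d}"

(* A j-linear form on R^d is a function of the list of its j arguments. *)

type_synonym mform = "pnt list \<Rightarrow> real"

definition multilinear_form :: "nat \<Rightarrow> nat \<Rightarrow> mform \<Rightarrow> bool" where
  "multilinear_form d j M \<longleftrightarrow>
     (\<forall>hs i u v a. length hs = j \<and> set hs \<subseteq> euc d \<and> i < j \<and> u \<in> euc d \<and> v \<in> euc d \<longrightarrow>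
        M (hs[i := vadd d u v]) = M (hs[i := u]) + M (hs[i := v]) \<and>
        M (hs[i := vscale d a u]) = a * M (hs[i := u]))"

definition form_norm :: "nat \<Rightarrow> nat \<Rightarrow> mform \<Rightarrow> ennreal" where
  "form_norm d j M =
     (SUP hs \<in> {hs. length hs = j \<and> (\<forall>h\<in>set hs. h \<in> euc d \<and> vnorm d h \<le> 1)}. ennreal \<bar>M hs\<bar>)"

(* The map F from R^d to the j-linear forms (with the operator norm) is Frechet differentiable at x;
   its derivative, a linear map from R^d to j-linear forms, is identified with the (j+1)-linear
   form M whose first argument is the direction of differentiation. *)

definition has_frechet_derivative :: "nat \<Rightarrow> nat \<Rightarrow> (pnt \<Rightarrow> mform) \<Rightarrow> mform \<Rightarrow> pnt \<Rightarrow> bool" where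
  "has_frechet_derivative d j F M x \<longleftrightarrow>
     multilinear_form d (Suc j) M \<and>
     (\<forall>\<epsilon>>0. \<exists>\<delta>>0. \<forall>h\<in>euc d. vnorm d h < \<delta> \<longrightarrow>
        form_norm d j (\<lambda>hs. F (vadd d x h) hs - F x hs - M (h # hs)) \<le> ennreal (\<epsilon> * vnorm d h))"

(* The choice is unique as far as arguments in R^d are concerned. *)

primrec frechet_deriv :: "nat \<Rightarrow> nat \<Rightarrow> (pnt \<Rightarrow> real) \<Rightarrow> pnt \<Rightarrow> mform" where
  "frechet_deriv d 0 f = (\<lambda>x hs. f x)"
| "frechet_deriv d (Suc j) f = (\<lambda>x. SOME M. has_frechet_derivative d j (frechet_deriv d j f) M x)"

definition times_differentiable :: "nat \<Rightarrow> nat \<Rightarrow> (pnt \<Rightarrow> real) \<Rightarrow> bool" where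
  "times_differentiable d k f \<longleftrightarrow>
     (\<forall>j<k. \<forall>x\<in>euc d. \<exists>M. has_frechet_derivative d j (frechet_deriv d j f) M x)"

definition holder_seminorm :: "nat \<Rightarrow> nat \<Rightarrow> real \<Rightarrow> (pnt \<Rightarrow> real) \<Rightarrow> ennreal" where
  "holder_seminorm d m \<rho> f =
     (SUP (x, y) \<in> {(x, y). x \<in> euc d \<and> y \<in> euc d \<and> x \<noteq> y}.
        form_norm d m (\<lambda>hs. frechet_deriv d m f x hs - frechet_deriv d m f y hs)
          / ennreal (vnorm d (vdiff d x y) powr \<rho>))"

(* Meaningful for functions f that are nat (floor s) times differentiable. *)

definition Cs_norm :: "nat \<Rightarrow> real \<Rightarrow> (pnt \<Rightarrow> real) \<Rightarrow> ennreal" where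
  "Cs_norm d s f =
     (let D = (SUP j \<in> {..nat \<lfloor>s\<rfloor>}. SUP x \<in> euc d. form_norm d j (frechet_deriv d j f x))
      in if s \<in> \<int> then D else max D (holder_seminorm d (nat \<lfloor>s\<rfloor>) (frac s) f))"

definition Cs_ball :: "nat \<Rightarrow> real \<Rightarrow> (pnt \<Rightarrow> real) set" where
  "Cs_ball d s = {f. times_differentiable d (nat \<lfloor>s\<rfloor>) f \<and> Cs_norm d s f \<le> 1}"

(* The normal distribution with mean \<theta> and covariance matrix \<sigma>^2 I_d. *)

definition gaussian :: "nat \<Rightarrow> pnt \<Rightarrow> real \<Rightarrow> pnt measure" where
  "gaussian d \<theta> \<sigma> = (\<Pi>\<^sub>M i\<in>{..<d}. density lborel (normal_density (\<theta> i) \<sigma>))"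

definition cov_matrix :: "real \<Rightarrow> nat \<Rightarrow> nat \<Rightarrow> real" where
  "cov_matrix \<sigma> i k = (if i = k then \<sigma>\<^sup>2 else 0)"

definition matrix_op_norm :: "nat \<Rightarrow> (nat \<Rightarrow> nat \<Rightarrow> real) \<Rightarrow> real" where
  "matrix_op_norm d A =
     (SUP u \<in> {u \<in> euc d. vnorm d u \<le> 1}. vnorm d (\<lambda>i\<in>{..<d}. \<Sum>k<d. A i k * u k))"

definition noise_second_moment :: "nat \<Rightarrow> real \<Rightarrow> real" where
  "noise_second_moment d \<sigma> = (\<integral>\<xi>. (vnorm d \<xi>)\<^sup>2 \<partial>gaussian d (vzero d) \<sigma>)"

definition estimators :: "nat \<Rightarrow> (pnt \<Rightarrow> real) set" where
  "estimators d = borel_measurable (\<Pi>\<^sub>M i\<in>{..<d}. (borel :: real measure))"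

definition sq_risk :: "nat \<Rightarrow> real \<Rightarrow> (pnt \<Rightarrow> real) \<Rightarrow> (pnt \<Rightarrow> real) \<Rightarrow> pnt \<Rightarrow> ennreal" where
  "sq_risk d \<sigma> f T \<theta> = (\<integral>\<^sup>+x. ennreal ((T x - f \<theta>)\<^sup>2) \<partial>gaussian d \<theta> \<sigma>)"

end

(* Fix disjointly supported bumps A (1 - |x - \<theta>|^2 / e^2)_+^K, with A of order e^s, around the points
   \<theta> of a well separated set I.  Every subset S of I gives a function of the C^s ball, the sum of the
   bumps centred in S, that separates S from its complement by A.  Under the uniform prior on I the
   Bayes risk for this function is at least A^2 times the posterior weight of the pairs cut by S.  If
   the posterior does not identify the parameter, then the pairs of distinct points carry a positive
   fraction of the weight, and some S cuts half of it.

   For the term (E |\<xi>|^2)^s, I is a Gilbert-Varshamov code in a cube of side of order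
   min(\<sigma>, 1 / sqrt d), so that e is of order min(\<sigma> sqrt d, 1); the code has exponentially many points,
   but each of them has a chi-square divergence of only exp(d / 16) from the centre.  For the term
   |\<Sigma>|, two points at a distance of order min(\<sigma>, 1) on the flank of a single bump suffice. *)

theory Submission
  imports Defs
begin

section \<open>Inner product and norm\<close>

text \<open>The function \<open>f\<close> is fixed before the estimator and known to it, so one
  \<open>f\<close> has to be hard for all \<open>T\<close>. Hence the cut may use only the prior and
  the likelihoods. Failure to identify the parameter does not by itself make a given
  \<open>f\<close> hard: a spread-out posterior may still charge only points with one value of
  \<open>f\<close>. A cut chosen by pair weights excludes this, because the posterior variance of
  \<open>f\<close> is a combination of these weights with coefficients \<open>(f i - f j)^2\<close>.
  The other obstacle is that the constant must not depend on \<open>d\<close>. Derivatives are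
  bounded by products of norms of the directions, with constants fixed before \<open>d\<close>; the
  number of bumps drops out because supports are disjoint; and code size beats divergence by a
  comparison of exponential rates, \<open>exp (1/16) \<le> 81/100 * 4/3\<close>, which works from
  \<open>d = 1\<close> on. The second construction is for \<open>s > 1\<close> and small
  \<open>d\<close>: bump heights of order \<open>(\<sigma> * sqrt d) powr s\<close> can then be far
  below \<sigma>, whereas one bump of radius 1 has slope of order 1.\<close>

definition ip :: "nat \<Rightarrow> pnt \<Rightarrow> pnt \<Rightarrow> real" where
  "ip d x y = (\<Sum>i<d. x i * y i)"

lemma ip_commute: "ip d x y = ip d y x"
  by (simp add: ip_def mult.commute)

lemma ip_self_nonneg: "0 \<le> ip d x x"
  by (simp add: ip_def sum_nonneg)

lemma vnorm_nonneg [simp]: "0 \<le> vnorm d x"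
  by (simp add: vnorm_def)

lemma vnorm_sq: "(vnorm d x)\<^sup>2 = ip d x x"
  by (simp add: vnorm_def L2_set_def ip_def sum_nonneg power2_eq_square)

lemma abs_ip_le: "\<bar>ip d x y\<bar> \<le> vnorm d x * vnorm d y"
proof -
  have "\<bar>ip d x y\<bar> \<le> (\<Sum>i<d. \<bar>x i\<bar> * \<bar>y i\<bar>)"
    unfolding ip_def by (rule order_trans[OF sum_abs]) (simp add: abs_mult)
  also have "\<dots> \<le> vnorm d x * vnorm d y"
    unfolding vnorm_def by (rule L2_set_mult_ineq)
  finally show ?thesis .
qed

lemma vadd_in_euc [simp]: "vadd d x y \<in> euc d"
  and vdiff_in_euc [simp]: "vdiff d x y \<in> euc d"
  and vscale_in_euc [simp]: "vscale d a x \<in> euc d"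
  and vzero_in_euc [simp]: "vzero d \<in> euc d"
  by (auto simp: euc_def vadd_def vdiff_def vscale_def vzero_def)

lemma euc_eqI: "x \<in> euc d \<Longrightarrow> y \<in> euc d \<Longrightarrow> (\<And>i. i < d \<Longrightarrow> x i = y i) \<Longrightarrow> x = y"
  unfolding euc_def by (rule PiE_ext) auto

lemma ip_vadd: "ip d (vadd d x y) g = ip d x g + ip d y g"
  by (simp add: ip_def vadd_def sum.distrib algebra_simps)

lemma ip_vscale: "ip d (vscale d a x) g = a * ip d x g"
  by (simp add: ip_def vscale_def sum_distrib_left algebra_simps)

lemma ip_vdiff: "ip d (vdiff d x y) g = ip d x g - ip d y g"
  by (simp add: ip_def vdiff_def sum_subtractf algebra_simps)

lemma ip_vzero: "ip d (vzero d) g = 0"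
  by (simp add: ip_def vzero_def)

lemmas ip_lin = ip_vadd ip_vscale ip_vdiff ip_vzero

lemma vnorm_eq_sqrt: "vnorm d x = sqrt (ip d x x)"
  by (simp add: vnorm_def L2_set_def ip_def power2_eq_square)

lemma vnorm_vscale: "vnorm d (vscale d a x) = \<bar>a\<bar> * vnorm d x"
proof -
  have "ip d (vscale d a x) (vscale d a x) = a\<^sup>2 * ip d x x"
    by (simp add: ip_commute[of d x "vscale d a x"] ip_lin power2_eq_square)
  thus ?thesis by (simp add: vnorm_eq_sqrt real_sqrt_mult)
qed

lemma vnorm_vadd_le: "vnorm d (vadd d x y) \<le> vnorm d x + vnorm d y"
proof -
  have "vnorm d (vadd d x y) = L2_set (\<lambda>i. x i + y i) {..<d}"
    unfolding vnorm_def by (rule L2_set_cong) (auto simp: vadd_def)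
  thus ?thesis using L2_set_triangle_ineq[of x y "{..<d}"] by (simp add: vnorm_def)
qed

lemma vadd_vscale_1: "u \<in> euc d \<Longrightarrow> v \<in> euc d \<Longrightarrow> vadd d u (vscale d 1 (vdiff d v u)) = v"
  by (rule euc_eqI[of _ d], simp, simp) (simp add: vadd_def vscale_def vdiff_def)

lemma vadd_vscale_0: "u \<in> euc d \<Longrightarrow> vadd d u (vscale d 0 v) = u"
  by (rule euc_eqI[of _ d], simp, simp) (simp add: vadd_def vscale_def vdiff_def)

lemma vadd_eq_vscale_1: "vadd d u h = vadd d u (vscale d 1 h)"
  by (rule euc_eqI[of _ d], simp, simp) (simp add: vadd_def vscale_def)


section \<open>Towers of derivatives\<close>

definition forms :: "nat \<Rightarrow> nat \<Rightarrow> pnt list set" where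
  "forms d j = {hs. length hs = j \<and> set hs \<subseteq> euc d}"

text \<open>The index set of the supremum in \<open>form_norm\<close>. The wider
  \<open>forms\<close> is kept beside it because mean value arguments use directions of arbitrary
  length, such as \<open>vdiff d x y\<close>.\<close>

definition unit_forms :: "nat \<Rightarrow> nat \<Rightarrow> pnt list set" where
  "unit_forms d j = {hs. length hs = j \<and> (\<forall>h\<in>set hs. h \<in> euc d \<and> vnorm d h \<le> 1)}"

definition norm_prod :: "nat \<Rightarrow> pnt list \<Rightarrow> real" where
  "norm_prod d hs = prod_list (map (vnorm d) hs)"

lemma norm_prod_simps [simp]:
  "norm_prod d [] = 1" "norm_prod d (h # hs) = vnorm d h * norm_prod d hs"
  by (simp_all add: norm_prod_def)

lemma norm_prod_nonneg [simp]: "0 \<le> norm_prod d hs"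
  by (induction hs) auto

lemma unit_formsD: "hs \<in> unit_forms d j \<Longrightarrow> hs \<in> forms d j"
  by (auto simp: forms_def unit_forms_def)

lemma norm_prod_unit_le: "hs \<in> unit_forms d j \<Longrightarrow> norm_prod d hs \<le> 1"
proof (induction hs arbitrary: j)
  case (Cons h hs)
  then have "hs \<in> unit_forms d (length hs)" "vnorm d h \<le> 1"
    by (auto simp: unit_forms_def)
  with Cons.IH show ?case using mult_mono[of "vnorm d h" 1 "norm_prod d hs" 1] by simp
qed simp

lemma form_norm_leI:
  "(\<And>hs. hs \<in> unit_forms d j \<Longrightarrow> \<bar>M hs\<bar> \<le> b) \<Longrightarrow> form_norm d j M \<le> ennreal b"
  unfolding form_norm_def unit_forms_def by (rule SUP_least) (auto intro: ennreal_leI)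

lemma form_normD:
  "form_norm d j M \<le> ennreal b \<Longrightarrow> 0 \<le> b \<Longrightarrow> hs \<in> unit_forms d j \<Longrightarrow> \<bar>M hs\<bar> \<le> b"
  by (rule iffD1[OF ennreal_le_iff[of b]], assumption, rule order_trans[rotated], assumption)
     (auto simp: form_norm_def unit_forms_def intro!: SUP_upper)

lemma form_norm_cong:
  "(\<And>hs. hs \<in> unit_forms d j \<Longrightarrow> M hs = N hs) \<Longrightarrow> form_norm d j M = form_norm d j N"
  unfolding form_norm_def unit_forms_def by (rule SUP_cong) auto

lemma has_frechet_derivative_cong:
  assumes "\<And>y hs. y \<in> euc d \<Longrightarrow> hs \<in> unit_forms d j \<Longrightarrow> F y hs = G y hs" "x \<in> euc d"
  shows "has_frechet_derivative d j F M x \<longleftrightarrow> has_frechet_derivative d j G M x"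
proof -
  have "form_norm d j (\<lambda>hs. F (vadd d x h) hs - F x hs - M (h # hs)) =
        form_norm d j (\<lambda>hs. G (vadd d x h) hs - G x hs - M (h # hs))" for h
    by (rule form_norm_cong) (simp add: assms)
  thus ?thesis by (simp add: has_frechet_derivative_def)
qed

text \<open>\<open>frechet_deriv\<close> is a Hilbert choice, so a computed derivative becomes its
  value only through uniqueness. Both remainders are \<open>o(t)\<close> along \<open>t * h\<close>,
  while the difference of the two forms there is exactly linear in \<open>t\<close>. Arguments
  outside \<open>euc d\<close> stay undetermined, hence the restriction to
  \<open>unit_forms\<close>.\<close>

lemma has_frechet_derivative_unique:
  assumes M: "has_frechet_derivative d j F M x" and N: "has_frechet_derivative d j F N x"
    and hs: "hs \<in> unit_forms d (Suc j)"
  shows "M hs = N hs"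
proof -
  obtain h hs' where hs_eq: "hs = h # hs'" using hs by (cases hs) (auto simp: unit_forms_def)
  have h: "h \<in> euc d" "vnorm d h \<le> 1" and hs': "hs' \<in> unit_forms d j"
    using hs by (auto simp: hs_eq unit_forms_def)
  have lin: "M' (vscale d t h # hs') = t * M' (h # hs')"
    if "has_frechet_derivative d j F M' x" for M' t
  proof -
    have "multilinear_form d (Suc j) M'" using that by (simp add: has_frechet_derivative_def)
    from this[unfolded multilinear_form_def, rule_format, of "h # hs'" 0 h h t]
    show ?thesis using h hs' by (auto simp: unit_forms_def)
  qed
  have "\<bar>M hs - N hs\<bar> \<le> e" if e: "e > 0" for e
  proof -
    from M e obtain d1 where d1: "d1 > 0" "\<forall>k\<in>euc d. vnorm d k < d1 \<longrightarrow>
        form_norm d j (\<lambda>hs. F (vadd d x k) hs - F x hs - M (k # hs)) \<le> ennreal (e/2 * vnorm d k)"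
      unfolding has_frechet_derivative_def by (meson half_gt_zero)
    from N e obtain d2 where d2: "d2 > 0" "\<forall>k\<in>euc d. vnorm d k < d2 \<longrightarrow>
        form_norm d j (\<lambda>hs. F (vadd d x k) hs - F x hs - N (k # hs)) \<le> ennreal (e/2 * vnorm d k)"
      unfolding has_frechet_derivative_def by (meson half_gt_zero)
    define t where "t = min d1 d2 / 2"
    have t: "0 < t" "t < d1" "t < d2" using d1 d2 by (auto simp: t_def)
    let ?k = "vscale d t h"
    have nk: "vnorm d ?k \<le> t" using h(2) t mult_left_mono[of "vnorm d h" 1 t]
      by (simp add: vnorm_vscale)
    have "\<bar>F (vadd d x ?k) hs' - F x hs' - M (?k # hs')\<bar> \<le> e/2 * vnorm d ?k"
      using d1(2) nk t hs' e by (intro form_normD[of d j _ _ hs']) auto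
    moreover have "\<bar>F (vadd d x ?k) hs' - F x hs' - N (?k # hs')\<bar> \<le> e/2 * vnorm d ?k"
      using d2(2) nk t hs' e by (intro form_normD[of d j _ _ hs']) auto
    ultimately have "\<bar>M (?k # hs') - N (?k # hs')\<bar> \<le> e * vnorm d ?k"
      by linarith
    also have "\<dots> \<le> e * t" using nk e by simp
    finally have "\<bar>t * (M hs - N hs)\<bar> \<le> e * t"
      using lin[OF M] lin[OF N] by (simp add: hs_eq algebra_simps)
    thus ?thesis using t by (simp add: abs_mult mult.commute)
  qed
  hence "\<bar>M hs - N hs\<bar> \<le> 0" by (rule field_le_epsilon) simp
  thus ?thesis by simp
qed

text \<open>Directional derivatives with one order of differentiability to spare: the mean value theorem
  then gives the uniform Frechet remainder, so that only one-dimensional derivatives have to be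
  computed.\<close>

definition deriv_tower :: "nat \<Rightarrow> nat \<Rightarrow> real \<Rightarrow> (nat \<Rightarrow> pnt \<Rightarrow> mform) \<Rightarrow> bool" where
  "deriv_tower d J B G \<longleftrightarrow>
     (\<forall>j\<le>J. \<forall>x. multilinear_form d j (G j x)) \<and>
     (\<forall>j<J. \<forall>x h hs t. x \<in> euc d \<and> h \<in> euc d \<and> hs \<in> forms d j \<longrightarrow>
        ((\<lambda>t. G j (vadd d x (vscale d t h)) hs) has_real_derivative
          G (Suc j) (vadd d x (vscale d t h)) (h # hs)) (at t)) \<and>
     (\<forall>j\<le>J. \<forall>x hs. x \<in> euc d \<and> hs \<in> forms d j \<longrightarrow> \<bar>G j x hs\<bar> \<le> B * norm_prod d hs)"

lemma
  assumes "deriv_tower d J B G"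
  shows deriv_tower_multilinear: "j \<le> J \<Longrightarrow> multilinear_form d j (G j x)"
    and deriv_tower_deriv: "j < J \<Longrightarrow> x \<in> euc d \<Longrightarrow> h \<in> euc d \<Longrightarrow> hs \<in> forms d j \<Longrightarrow>
        ((\<lambda>t. G j (vadd d x (vscale d t h)) hs) has_real_derivative
          G (Suc j) (vadd d x (vscale d t h)) (h # hs)) (at t)"
    and deriv_tower_bound: "j \<le> J \<Longrightarrow> x \<in> euc d \<Longrightarrow> hs \<in> forms d j \<Longrightarrow>
        \<bar>G j x hs\<bar> \<le> B * norm_prod d hs"
  using assms unfolding deriv_tower_def by blast+

lemma deriv_tower_line_diff:
  assumes G: "deriv_tower d J B G" and j: "j < J" and x: "x \<in> euc d" and h: "h \<in> euc d"
    and hs: "hs \<in> forms d j" and t: "0 < t"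
  shows "\<exists>\<xi>>0. \<xi> < t \<and>
    G j (vadd d x (vscale d t h)) hs - G j x hs = t * G (Suc j) (vadd d x (vscale d \<xi> h)) (h # hs)"
proof -
  have "\<exists>z>0. z < t \<and> G j (vadd d x (vscale d t h)) hs - G j (vadd d x (vscale d 0 h)) hs =
        (t - 0) * G (Suc j) (vadd d x (vscale d z h)) (h # hs)"
    by (rule MVT2[OF t]) (rule deriv_tower_deriv[OF G j x h hs])
  thus ?thesis by (simp add: vadd_vscale_0[OF x])
qed

text \<open>Boundedness at order \<open>j + 1\<close> is spent on a Lipschitz bound at order
  \<open>j\<close>; at the top order this is one half of the Holder estimate.\<close>

lemma deriv_tower_lipschitz:
  assumes G: "deriv_tower d J B G" and j: "j < J" and x: "x \<in> euc d" and y: "y \<in> euc d"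
    and hs: "hs \<in> forms d j"
  shows "\<bar>G j x hs - G j y hs\<bar> \<le> B * vnorm d (vdiff d x y) * norm_prod d hs"
proof -
  obtain \<xi> where "G j (vadd d y (vscale d 1 (vdiff d x y))) hs - G j y hs =
      1 * G (Suc j) (vadd d y (vscale d \<xi> (vdiff d x y))) (vdiff d x y # hs)"
    using deriv_tower_line_diff[OF G j y vdiff_in_euc[of d x y] hs zero_less_one]
    by (elim exE conjE) (rule that)
  thus ?thesis using deriv_tower_bound[OF G, of "Suc j" "vadd d y (vscale d \<xi> (vdiff d x y))"
        "vdiff d x y # hs"] j hs
    by (simp add: vadd_vscale_1[OF y x] forms_def mult.assoc)
qed

text \<open>The mean value theorem, applied twice along the segment, gives the remainder
  \<open>B * |h|^2\<close> uniformly over unit arguments. The second application consumes the order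
  \<open>j + 2\<close>, hence \<open>Suc j < J\<close>.\<close>

lemma deriv_tower_has_frechet_derivative:
  assumes G: "deriv_tower d J B G" and j: "Suc j < J" and x: "x \<in> euc d" and B: "0 \<le> B"
  shows "has_frechet_derivative d j (G j) (G (Suc j) x) x"
  unfolding has_frechet_derivative_def
proof (intro conjI allI impI)
  show "multilinear_form d (Suc j) (G (Suc j) x)"
    using deriv_tower_multilinear[OF G] j by simp
  fix e :: real assume e: "e > 0"
  show "\<exists>\<delta>>0. \<forall>h\<in>euc d. vnorm d h < \<delta> \<longrightarrow> form_norm d j
          (\<lambda>hs. G j (vadd d x h) hs - G j x hs - G (Suc j) x (h # hs)) \<le> ennreal (e * vnorm d h)"
  proof (intro exI conjI ballI impI)
    \<comment> \<open>\<open>B + 1\<close> rather than \<open>B\<close>, which may be 0.\<close>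
    show "e / (B + 1) > 0" using e B by simp
    fix h assume h: "h \<in> euc d" "vnorm d h < e / (B + 1)"
    show "form_norm d j (\<lambda>hs. G j (vadd d x h) hs - G j x hs - G (Suc j) x (h # hs))
        \<le> ennreal (e * vnorm d h)"
    proof (rule form_norm_leI)
      fix hs assume hs: "hs \<in> unit_forms d j"
      note hs1 = unit_formsD[OF hs]
      have hs2: "h # hs \<in> forms d (Suc j)" using hs1 h by (simp add: forms_def)
      have hs3: "h # h # hs \<in> forms d (Suc (Suc j))" using hs1 h by (simp add: forms_def)
      obtain \<xi> where xi: "0 < \<xi>" "\<xi> < 1"
        "G j (vadd d x (vscale d 1 h)) hs - G j x hs = 1 * G (Suc j) (vadd d x (vscale d \<xi> h)) (h # hs)"
        using deriv_tower_line_diff[OF G Suc_lessD[OF j] x h(1) hs1 zero_less_one]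
        by (elim exE conjE) (rule that)
      obtain \<zeta> where zeta: "G (Suc j) (vadd d x (vscale d \<xi> h)) (h # hs) - G (Suc j) x (h # hs) =
          \<xi> * G (Suc (Suc j)) (vadd d x (vscale d \<zeta> h)) (h # h # hs)"
        using deriv_tower_line_diff[OF G j x h(1) hs2 xi(1)] by (elim exE conjE) (rule that)
      have "\<bar>G j (vadd d x h) hs - G j x hs - G (Suc j) x (h # hs)\<bar> =
          \<xi> * \<bar>G (Suc (Suc j)) (vadd d x (vscale d \<zeta> h)) (h # h # hs)\<bar>"
        using xi zeta unfolding vadd_eq_vscale_1[of d x h] by (simp add: abs_mult)
      also have "\<dots> \<le> 1 * (B * norm_prod d (h # h # hs))"
        using xi j by (intro mult_mono deriv_tower_bound[OF G _ _ hs3]) auto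
      also have "\<dots> = B * (vnorm d h * vnorm d h) * norm_prod d hs" by simp
      also have "\<dots> \<le> B * (vnorm d h * vnorm d h) * 1"
        using norm_prod_unit_le[OF hs] B by (intro mult_left_mono) auto
      also have "\<dots> = (B * vnorm d h) * vnorm d h" by simp
      also have "\<dots> \<le> e * vnorm d h"
      proof (rule mult_right_mono)
        have "B * vnorm d h \<le> (B + 1) * vnorm d h" by (simp add: algebra_simps)
        also have "\<dots> \<le> e" using h(2) B by (simp add: field_simps)
        finally show "B * vnorm d h \<le> e" .
      qed simp
      finally show "\<bar>G j (vadd d x h) hs - G j x hs - G (Suc j) x (h # hs)\<bar> \<le> e * vnorm d h" .
    qed
  qed
qed

text \<open>Inductively, the chosen derivative of order \<open>j\<close> agrees with
  \<open>G j\<close> wherever \<open>form_norm\<close> looks, so both have the same derivatives. The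
  tower supplies one, hence the choice returns a genuine derivative, and uniqueness identifies
  it.\<close>

lemma frechet_deriv_eq_tower:
  assumes G: "deriv_tower d J B G" and B: "0 \<le> B" and f: "\<And>x. x \<in> euc d \<Longrightarrow> f x = G 0 x []"
  shows "j < J \<Longrightarrow> x \<in> euc d \<Longrightarrow> hs \<in> unit_forms d j \<Longrightarrow> frechet_deriv d j f x hs = G j x hs"
proof (induction j arbitrary: x hs)
  case 0
  thus ?case by (simp add: f unit_forms_def)
next
  case (Suc j)
  have "has_frechet_derivative d j (frechet_deriv d j f) M x \<longleftrightarrow> has_frechet_derivative d j (G j) M x" for M
    by (rule has_frechet_derivative_cong) (use Suc in auto)
  hence *: "has_frechet_derivative d j (frechet_deriv d j f) (G (Suc j) x) x"
    using deriv_tower_has_frechet_derivative[OF G Suc.prems(1,2) B] by simp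
  hence "has_frechet_derivative d j (frechet_deriv d j f) (frechet_deriv d (Suc j) f x) x"
    unfolding frechet_deriv.simps by (rule someI[of "\<lambda>M. has_frechet_derivative d j (frechet_deriv d j f) M x"])
  from has_frechet_derivative_unique[OF this * Suc.prems(3)] show ?case .
qed

lemma times_differentiable_tower:
  assumes G: "deriv_tower d J B G" and B: "0 \<le> B" and f: "\<And>x. x \<in> euc d \<Longrightarrow> f x = G 0 x []"
    and k: "k < J"
  shows "times_differentiable d k f"
  unfolding times_differentiable_def
proof (intro allI impI ballI exI)
  fix j x assume j: "j < k" and x: "x \<in> euc d"
  have "has_frechet_derivative d j (frechet_deriv d j f) M x \<longleftrightarrow> has_frechet_derivative d j (G j) M x" for M
    by (rule has_frechet_derivative_cong[OF _ x], rule frechet_deriv_eq_tower[OF G B f])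
       (use j k in auto)
  thus "has_frechet_derivative d j (frechet_deriv d j f) (G (Suc j) x) x"
    using deriv_tower_has_frechet_derivative[OF G _ x B, of j] j k by simp
qed

text \<open>The extra order of the tower pays for the Frechet remainder. \<open>B\<close> only has
  to exist; the size condition rests on \<open>bd\<close> and \<open>hd\<close>. For integer
  \<open>s\<close> the exponent \<open>frac s\<close> is 0 and \<open>hd\<close> bounds an
  oscillation by 1, so that all \<open>s\<close> are treated alike.\<close>

lemma Cs_ball_tower:
  assumes s: "s > 0" and G: "deriv_tower d (Suc (nat \<lfloor>s\<rfloor>)) B G" and B: "0 \<le> B"
    and f: "\<And>x. x \<in> euc d \<Longrightarrow> f x = G 0 x []"
    and bd: "\<And>j x hs. j \<le> nat \<lfloor>s\<rfloor> \<Longrightarrow> x \<in> euc d \<Longrightarrow> hs \<in> unit_forms d j \<Longrightarrow> \<bar>G j x hs\<bar> \<le> 1"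
    and hd: "\<And>x y hs. x \<in> euc d \<Longrightarrow> y \<in> euc d \<Longrightarrow> hs \<in> unit_forms d (nat \<lfloor>s\<rfloor>) \<Longrightarrow>
       \<bar>G (nat \<lfloor>s\<rfloor>) x hs - G (nat \<lfloor>s\<rfloor>) y hs\<bar> \<le> vnorm d (vdiff d x y) powr frac s"
  shows "f \<in> Cs_ball d s"
proof -
  note eq = frechet_deriv_eq_tower[OF G B f]
  have "form_norm d j (frechet_deriv d j f x) \<le> 1" if "j \<le> nat \<lfloor>s\<rfloor>" "x \<in> euc d" for j x
  proof -
    have "form_norm d j (frechet_deriv d j f x) \<le> ennreal 1"
      by (rule form_norm_leI) (use that eq bd in simp)
    thus ?thesis by simp
  qed
  hence 1: "(SUP j \<in> {..nat \<lfloor>s\<rfloor>}. SUP x \<in> euc d. form_norm d j (frechet_deriv d j f x)) \<le> 1"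
    by (intro SUP_least) auto
  have 2: "holder_seminorm d (nat \<lfloor>s\<rfloor>) (frac s) f \<le> 1"
    unfolding holder_seminorm_def
  proof (rule SUP_least, clarify)
    fix x y assume xy: "x \<in> euc d" "y \<in> euc d" "x \<noteq> y"
    let ?v = "vnorm d (vdiff d x y)"
    have "?v \<noteq> 0"
    proof
      assume "?v = 0"
      hence "\<forall>i<d. vdiff d x y i = 0" by (simp add: vnorm_def L2_set_eq_0_iff)
      hence "x = y" using xy by (intro euc_eqI[of x d y]) (auto simp: vdiff_def)
      thus False using xy by simp
    qed
    hence v: "?v powr frac s > 0" by simp
    have "form_norm d (nat \<lfloor>s\<rfloor>) (\<lambda>hs. frechet_deriv d (nat \<lfloor>s\<rfloor>) f x hs - frechet_deriv d (nat \<lfloor>s\<rfloor>) f y hs)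
        \<le> ennreal (?v powr frac s)"
      using xy hd by (intro form_norm_leI) (simp add: eq)
    thus "form_norm d (nat \<lfloor>s\<rfloor>) (\<lambda>hs. frechet_deriv d (nat \<lfloor>s\<rfloor>) f x hs - frechet_deriv d (nat \<lfloor>s\<rfloor>) f y hs)
        / ennreal (?v powr frac s) \<le> 1"
      using v by (intro divide_le_posI_ennreal) auto
  qed
  show ?thesis using 1 2 times_differentiable_tower[OF G B f, of "nat \<lfloor>s\<rfloor>"]
    by (auto simp: Cs_ball_def Cs_norm_def Let_def)
qed

section \<open>Radial bumps\<close>

text \<open>An exponent of at least 2 makes the two branches glue at the kink.\<close>

lemma max_power_has_derivative:
  fixes x :: real
  shows "((\<lambda>x. max 0 (1 - x) ^ Suc (Suc k)) has_real_derivative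
      - real (Suc (Suc k)) * max 0 (1 - x) ^ Suc k) (at x)"
proof -
  consider "x < 1" | "x > 1" | "x = 1" by linarith
  thus ?thesis
  proof cases
    case 1
    have "((\<lambda>x. (1 - x) ^ Suc (Suc k)) has_real_derivative - real (Suc (Suc k)) * (1 - x) ^ Suc k) (at x)"
      by (rule DERIV_cong, (rule derivative_eq_intros refl)+) (simp add: algebra_simps)
    hence "((\<lambda>x. max 0 (1 - x) ^ Suc (Suc k)) has_real_derivative - real (Suc (Suc k)) * (1 - x) ^ Suc k) (at x)"
      by (rule has_field_derivative_transform_within_open[where S = "{..<1}"]) (use 1 in auto)
    thus ?thesis using 1 by simp
  next
    case 2
    have "((\<lambda>x. max 0 (1 - x) ^ Suc (Suc k)) has_real_derivative 0) (at x)"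
      by (rule has_field_derivative_transform_within_open[where S = "{1<..}" and f = "\<lambda>_. 0"])
         (use 2 in auto)
    thus ?thesis using 2 by simp
  next
    case 3
    \<comment> \<open>At the kink the difference factors through \<open>z - x\<close> with a
      continuous cofactor, which is Caratheodory's criterion for the derivative.\<close>
    have eq: "max 0 (1 - z) ^ Suc (Suc k) - max 0 (1 - x) ^ Suc (Suc k) =
        - (max 0 (1 - z) ^ Suc k) * (z - x)" for z :: real
      using 3 by (simp add: max_def algebra_simps)
    have "isCont (\<lambda>z. - (max 0 (1 - z) ^ Suc k)) x"
      by (intro continuous_intros)
    thus ?thesis unfolding CARAT_DERIV
      by (intro exI[of _ "\<lambda>z. - (max 0 (1 - z) ^ Suc k)"]) (use eq 3 in simp)
  qed
qed

text \<open>The \<open>n\<close>-th derivative of \<open>u \<mapsto> max 0 (1 - u) ^ K\<close>, for \<open>n < K\<close>.\<close>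

definition psi :: "nat \<Rightarrow> nat \<Rightarrow> real \<Rightarrow> real" where
  "psi K n u = (-1) ^ n * (\<Prod>i<n. real (K - i)) * max 0 (1 - u) ^ (K - n)"

lemma psi_has_derivative:
  assumes "n + 2 \<le> K"
  shows "(psi K n has_real_derivative psi K (Suc n) u) (at u)"
proof -
  obtain k where k: "K - n = Suc (Suc k)" using assms by (cases "K - n"; cases "K - n - 1") auto
  have k': "K - Suc n = Suc k" using k by simp
  show ?thesis unfolding psi_def[abs_def] k k'
    by (rule DERIV_cong[OF DERIV_cmult[OF max_power_has_derivative]]) (simp add: k k' algebra_simps)
qed

lemma psi_eq_0: "n < K \<Longrightarrow> 1 \<le> u \<Longrightarrow> psi K n u = 0"
  by (simp add: psi_def max_def)

lemma abs_psi_le: "0 \<le> u \<Longrightarrow> \<bar>psi K n u\<bar> \<le> (\<Prod>i<n. real (K - i))"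
  by (auto simp: psi_def abs_mult abs_prod power_abs prod_nonneg intro!: mult_right_le_one_le power_le_one)

section \<open>Iterated directional derivatives of a radial bump\<close>

definition del :: "nat \<Rightarrow> 'a list \<Rightarrow> 'a list" where
  "del k hs = take k hs @ drop (Suc k) hs"

lemma length_del: "k < length hs \<Longrightarrow> length (del k hs) = length hs - 1"
  by (simp add: del_def)

lemma length_del_le: "length (del k hs) \<le> length hs"
  by (simp add: del_def)

lemma del_append1: "k < length hs \<Longrightarrow> del k (hs @ gs) = del k hs @ gs"
  by (simp add: del_def)

lemma del_last: "del (length hs) (hs @ [g]) = hs"
  by (simp add: del_def)

lemma del_update_eq: "del i (hs[i := w]) = del i hs"
  by (simp add: del_def)

text \<open>In \<open>bump_form\<close>, \<open>del\<close> removes a direction already spent on the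
  linear factor; a slot behind it moves down by one.\<close>

lemma del_update_neq:
  assumes "k \<noteq> i" "k < length hs" "i < length hs"
  shows "del k (hs[i := w]) = (del k hs)[(if i < k then i else i - 1) := w]"
proof (rule nth_equalityI)
  fix l assume "l < length (del k (hs[i := w]))"
  thus "del k (hs[i := w]) ! l = (del k hs)[(if i < k then i else i - 1) := w] ! l"
    using assms by (cases i) (auto simp: del_def nth_append nth_list_update min_def)
qed (use assms in \<open>simp add: length_del\<close>)

lemma norm_prod_del:
  "k < length hs \<Longrightarrow> vnorm d (hs ! k) * norm_prod d (del k hs) = norm_prod d hs"
proof (induction hs arbitrary: k)
  case (Cons h hs)
  thus ?case by (cases k) (auto simp: del_def algebra_simps)
qed simp

lemma norm_prod_rev [simp]: "norm_prod d (rev hs) = norm_prod d hs"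
  by (simp add: norm_prod_def rev_map[symmetric] prod_list.rev)

text \<open>\<open>bump_form d K n [h1, \<dots>, hj] y\<close> is the iterated directional derivative of
  \<open>psi K n (ip d y y)\<close>, with \<open>h1\<close> the direction of the first differentiation: that one produces the
  factor \<open>2 * ip d y h1\<close>, which the Leibniz rule for the others either leaves alone or differentiates
  once.\<close>

function bump_form :: "nat \<Rightarrow> nat \<Rightarrow> nat \<Rightarrow> pnt list \<Rightarrow> pnt \<Rightarrow> real" where
  "bump_form d K n [] y = psi K n (ip d y y)"
| "bump_form d K n (h # hs) y = 2 * ip d y h * bump_form d K (Suc n) hs y +
     (\<Sum>k<length hs. 2 * ip d (hs ! k) h * bump_form d K (Suc n) (del k hs) y)"
  by pat_completeness auto
termination
  by (relation "Wellfounded.measure (\<lambda>(d, K, n, hs, y). length hs)") (auto simp: le_imp_less_Suc[OF length_del_le])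

text \<open>The curve enters only through derivatives of inner products, because rescaled points
  need not lie in \<open>euc d\<close>. The newest direction goes to the end of the list, whose head
  is the first one.\<close>

lemma bump_form_has_derivative:
  assumes "\<And>g. ((\<lambda>t. ip d (y t) g) has_real_derivative ip d y' g) (at t)"
    and "((\<lambda>t. ip d (y t) (y t)) has_real_derivative 2 * ip d (y t) y') (at t)"
    and "n + length hs + 2 \<le> K"
  shows "((\<lambda>t. bump_form d K n hs (y t)) has_real_derivative bump_form d K n (hs @ [y']) (y t)) (at t)"
  using assms(3)
proof (induction "length hs" arbitrary: hs n rule: less_induct)
  case less
  show ?case
  proof (cases hs)
    case Nil
    have "((\<lambda>t. psi K n (ip d (y t) (y t))) has_real_derivative
        psi K (Suc n) (ip d (y t) (y t)) * (2 * ip d (y t) y')) (at t)"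
      by (rule DERIV_chain2[OF psi_has_derivative assms(2)]) (use less.prems Nil in simp)
    thus ?thesis by (simp add: Nil mult.commute)
  next
    case (Cons h gs)
    have 1: "((\<lambda>t. bump_form d K (Suc n) gs (y t)) has_real_derivative
        bump_form d K (Suc n) (gs @ [y']) (y t)) (at t)"
      by (rule less.hyps) (use less.prems Cons in auto)
    have 2: "((\<lambda>t. bump_form d K (Suc n) (del k gs) (y t)) has_real_derivative
        bump_form d K (Suc n) (del k gs @ [y']) (y t)) (at t)" if "k < length gs" for k
      by (rule less.hyps) (use less.prems Cons that in \<open>auto simp: length_del\<close>)
    have "((\<lambda>t. 2 * ip d (y t) h * bump_form d K (Suc n) gs (y t) +
         (\<Sum>k<length gs. 2 * ip d (gs ! k) h * bump_form d K (Suc n) (del k gs) (y t)))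
        has_real_derivative
         (2 * ip d (y t) h * bump_form d K (Suc n) (gs @ [y']) (y t) +
          2 * ip d y' h * bump_form d K (Suc n) gs (y t)) +
         (\<Sum>k<length gs. 2 * ip d (gs ! k) h * bump_form d K (Suc n) (del k gs @ [y']) (y t))) (at t)"
      by (intro DERIV_add DERIV_sum DERIV_cmult 2)
         (auto intro!: DERIV_cong[OF DERIV_mult[OF DERIV_cmult[OF assms(1)] 1]])
    \<comment> \<open>Over \<open>gs @ [y']\<close> the sum has one more summand,
      \<open>k = length gs\<close>, in which the new direction differentiates the linear factor. The
      other deletions commute with the append.\<close>
    also have "(2 * ip d (y t) h * bump_form d K (Suc n) (gs @ [y']) (y t) +
          2 * ip d y' h * bump_form d K (Suc n) gs (y t)) +
         (\<Sum>k<length gs. 2 * ip d (gs ! k) h * bump_form d K (Suc n) (del k gs @ [y']) (y t)) =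
         bump_form d K n (hs @ [y']) (y t)"
      by (simp add: Cons del_last nth_append del_append1)
    finally show ?thesis by (simp add: Cons)
  qed
qed

text \<open>Linearity is stated for one combination with coefficients \<open>a\<close> and
  \<open>b\<close>, so that additivity, homogeneity and the extraction of the factor
  \<open>1 / e\<close> are all instances. The vectors matter only through \<open>ip\<close>.\<close>

lemma bump_form_slot:
  assumes w: "\<And>g. ip d w g = a * ip d u g + b * ip d v g" and "i < length hs"
  shows "bump_form d K n (hs[i := w]) y =
    a * bump_form d K n (hs[i := u]) y + b * bump_form d K n (hs[i := v]) y"
  using assms(2)
proof (induction "length hs" arbitrary: hs n i rule: less_induct)
  case less
  obtain h gs where hs: "hs = h # gs" using less.prems by (cases hs) auto
  show ?case
  proof (cases i)
    case 0
    show ?thesis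
      by (simp add: hs 0 ip_commute[of d _ w] w ip_commute[of d _ u] ip_commute[of d _ v]
          sum_distrib_left algebra_simps sum.distrib)
  next
    case (Suc l)
    have l: "l < length gs" using less.prems by (simp add: hs Suc)
    have 1: "bump_form d K (Suc n) (gs[l := w]) y =
        a * bump_form d K (Suc n) (gs[l := u]) y + b * bump_form d K (Suc n) (gs[l := v]) y"
      by (rule less.hyps) (use l hs in auto)
    have 2: "ip d (gs[l := w] ! k) h * bump_form d K (Suc n) (del k (gs[l := w])) y =
        a * (ip d (gs[l := u] ! k) h * bump_form d K (Suc n) (del k (gs[l := u])) y) +
        b * (ip d (gs[l := v] ! k) h * bump_form d K (Suc n) (del k (gs[l := v])) y)"
      if k: "k < length gs" for k
    \<comment> \<open>The changed slot is either the one paired with \<open>h\<close> or a slot of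
      the remaining list, possibly with a shifted index.\<close>
    proof (cases "k = l")
      case True
      thus ?thesis using k by (simp add: del_update_eq w algebra_simps)
    next
      case False
      have "bump_form d K (Suc n) ((del k gs)[(if l < k then l else l - 1) := w]) y =
        a * bump_form d K (Suc n) ((del k gs)[(if l < k then l else l - 1) := u]) y +
        b * bump_form d K (Suc n) ((del k gs)[(if l < k then l else l - 1) := v]) y"
        by (rule less.hyps) (use k l False hs in \<open>auto simp: length_del\<close>)
      thus ?thesis using k False l by (simp add: del_update_neq algebra_simps)
    qed
    have 3: "(\<Sum>k<length gs. 2 * (ip d (gs[l := w] ! k) h * bump_form d K (Suc n) (del k (gs[l := w])) y)) =
        a * (\<Sum>k<length gs. 2 * (ip d (gs[l := u] ! k) h * bump_form d K (Suc n) (del k (gs[l := u])) y)) +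
        b * (\<Sum>k<length gs. 2 * (ip d (gs[l := v] ! k) h * bump_form d K (Suc n) (del k (gs[l := v])) y))"
      unfolding sum_distrib_left sum.distrib[symmetric]
      by (rule sum.cong) (use 2 in \<open>auto simp: algebra_simps\<close>)
    show ?thesis using 1 3 by (simp add: hs Suc mult.assoc algebra_simps)
  qed
qed

lemma multilinear_bump_form: "multilinear_form d j (\<lambda>hs. c * bump_form d K n (rev hs) y)"
  unfolding multilinear_form_def
proof (intro allI impI, elim conjE)
  fix hs :: "pnt list" and i u v a assume hs: "length hs = j" "i < j"
  have add: "bump_form d K n (rev (hs[i := vadd d u v])) y =
      1 * bump_form d K n (rev (hs[i := u])) y + 1 * bump_form d K n (rev (hs[i := v])) y"
    using hs unfolding rev_update[OF hs(2)[folded hs(1)]]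
    by (intro bump_form_slot) (auto simp: ip_lin)
  have scale: "bump_form d K n (rev (hs[i := vscale d a u])) y =
      a * bump_form d K n (rev (hs[i := u])) y + 0 * bump_form d K n (rev (hs[i := u])) y"
    using hs unfolding rev_update[OF hs(2)[folded hs(1)]]
    by (intro bump_form_slot) (auto simp: ip_lin)
  show "c * bump_form d K n (rev (hs[i := vadd d u v])) y =
      c * bump_form d K n (rev (hs[i := u])) y + c * bump_form d K n (rev (hs[i := v])) y \<and>
      c * bump_form d K n (rev (hs[i := vscale d a u])) y = a * (c * bump_form d K n (rev (hs[i := u])) y)"
    using add scale by (simp add: algebra_simps)
qed

text \<open>Every recursive call raises the order by one and shortens the list by at least one, so
  only \<open>psi\<close> of order below \<open>K\<close> occurs, and these functions vanish from
  the unit sphere outwards.\<close>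

lemma bump_form_eq_0: "n + length hs < K \<Longrightarrow> 1 \<le> ip d y y \<Longrightarrow> bump_form d K n hs y = 0"
proof (induction "length hs" arbitrary: hs n rule: less_induct)
  case less
  show ?case
  proof (cases hs)
    case (Cons h gs)
    have "bump_form d K (Suc n) gs y = 0" by (rule less.hyps) (use less.prems Cons in auto)
    moreover have "bump_form d K (Suc n) (del k gs) y = 0" if "k < length gs" for k
      by (rule less.hyps) (use less.prems Cons that in \<open>auto simp: length_del\<close>)
    ultimately show ?thesis by (simp add: Cons)
  qed (use less.prems in \<open>simp add: psi_eq_0\<close>)
qed

text \<open>The constant is chosen before \<open>d\<close>. This is possible because the recursion
  has only as many terms as there are directions, and each inner product costs a product of norms by
  Cauchy-Schwarz, never a sum over coordinates.\<close>

lemma bump_form_bounded: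
  "\<exists>B\<ge>0. \<forall>d hs y. length hs = j \<longrightarrow> vnorm d y \<le> 1 \<longrightarrow>
     \<bar>bump_form d K n hs y\<bar> \<le> B * norm_prod d hs"
proof (induction j arbitrary: n rule: less_induct)
  case (less j)
  show ?case
  proof (cases j)
    case 0
    show ?thesis
      by (rule exI[of _ "\<Prod>i<n. real (K - i)"]) (auto simp: 0 abs_psi_le ip_self_nonneg prod_nonneg)
  next
    case (Suc l)
    obtain B1 where B1: "B1 \<ge> 0" "\<And>d hs y. length hs = l \<Longrightarrow> vnorm d y \<le> 1 \<Longrightarrow>
        \<bar>bump_form d K (Suc n) hs y\<bar> \<le> B1 * norm_prod d hs"
      using less.IH[of l "Suc n"] Suc by auto
    \<comment> \<open>For \<open>l = 0\<close> the truncated \<open>l - 1\<close> does no harm: the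
      sum over deletions is then empty.\<close>
    obtain B2 where B2: "B2 \<ge> 0" "\<And>d hs y. length hs = l - 1 \<Longrightarrow> vnorm d y \<le> 1 \<Longrightarrow>
        \<bar>bump_form d K (Suc n) hs y\<bar> \<le> B2 * norm_prod d hs"
      using less.IH[of "l - 1" "Suc n"] Suc by (auto simp only: less_Suc_eq_le diff_le_self)
    have "\<bar>bump_form d K n hs y\<bar> \<le> (2 * B1 + 2 * real l * B2) * norm_prod d hs"
      if hs: "length hs = j" and y: "vnorm d y \<le> 1" for d hs y
    proof -
      obtain h gs where hs_eq: "hs = h # gs" using hs Suc by (cases hs) auto
      have l: "length gs = l" using hs Suc hs_eq by simp
      have "\<bar>ip d y h\<bar> \<le> 1 * vnorm d h"
        by (rule order_trans[OF abs_ip_le]) (use y in \<open>intro mult_right_mono; simp\<close>)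
      hence "\<bar>2 * ip d y h * bump_form d K (Suc n) gs y\<bar> \<le> (2 * vnorm d h) * (B1 * norm_prod d gs)"
        unfolding abs_mult by (intro mult_mono B1(2)[OF l y]) auto
      moreover have "\<bar>2 * ip d (gs ! k) h * bump_form d K (Suc n) (del k gs) y\<bar>
          \<le> 2 * (vnorm d h * norm_prod d gs * B2)" if k: "k < length gs" for k
      proof -
        have "\<bar>2 * ip d (gs ! k) h * bump_form d K (Suc n) (del k gs) y\<bar>
            \<le> (2 * (vnorm d (gs ! k) * vnorm d h)) * (B2 * norm_prod d (del k gs))"
          unfolding abs_mult
          by (intro mult_mono abs_ip_le B2(2) y) (use k l in \<open>auto simp: length_del\<close>)
        thus ?thesis using norm_prod_del[OF k, of d, symmetric] by (simp add: algebra_simps)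
      qed
      hence "\<bar>\<Sum>k<length gs. 2 * ip d (gs ! k) h * bump_form d K (Suc n) (del k gs) y\<bar>
          \<le> real l * (2 * (vnorm d h * norm_prod d gs * B2))"
        using sum_bounded_above[of "{..<length gs}" "\<lambda>k. \<bar>2 * ip d (gs ! k) h * bump_form d K (Suc n) (del k gs) y\<bar>"]
        by (intro order_trans[OF sum_abs]) (simp add: l)
      ultimately show ?thesis unfolding hs_eq bump_form.simps norm_prod_simps
        by (intro order_trans[OF abs_triangle_ineq]) (simp add: algebra_simps)
    qed
    thus ?thesis using B1(1) B2(1) by (intro exI[of _ "2 * B1 + 2 * real l * B2"]) auto
  qed
qed

lemma bump_form_bounded_uniform:
  "\<exists>B\<ge>1. \<forall>d hs y. length hs \<le> J \<longrightarrow> vnorm d y \<le> 1 \<longrightarrow>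
     \<bar>bump_form d K n hs y\<bar> \<le> B * norm_prod d hs"
proof -
  obtain B where B: "\<And>j. B j \<ge> 0" "\<And>j d hs y. length hs = j \<Longrightarrow> vnorm d y \<le> 1 \<Longrightarrow>
      \<bar>bump_form d K n hs y\<bar> \<le> B j * norm_prod d hs"
    using bump_form_bounded[of _ K n] by metis
  have "\<bar>bump_form d K n hs y\<bar> \<le> (1 + (\<Sum>j\<le>J. B j)) * norm_prod d hs"
    if "length hs \<le> J" "vnorm d y \<le> 1" for d hs y
  proof -
    have "B (length hs) \<le> (\<Sum>j\<le>J. B j)" using that B(1) by (intro member_le_sum) auto
    thus ?thesis
      using that by (intro order_trans[OF B(2)[OF refl]] mult_right_mono) auto
  qed
  thus ?thesis using B(1) by (intro exI[of _ "1 + (\<Sum>j\<le>J. B j)"]) (auto intro: sum_nonneg)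
qed

section \<open>Bumps moved to a centre and scaled to a radius\<close>

definition rescale :: "real \<Rightarrow> pnt \<Rightarrow> pnt \<Rightarrow> pnt" where
  "rescale e \<theta> x = (\<lambda>i. (x i - \<theta> i) / e)"

lemma vnorm_rescale: "0 < e \<Longrightarrow> vnorm d (rescale e \<theta> x) = vnorm d (vdiff d x \<theta>) / e"
proof -
  assume e: "0 < e"
  have "ip d (rescale e \<theta> x) (rescale e \<theta> x) = ip d (vdiff d x \<theta>) (vdiff d x \<theta>) / e\<^sup>2"
    by (simp add: ip_def rescale_def vdiff_def sum_divide_distrib power2_eq_square)
  thus ?thesis using e by (simp add: vnorm_eq_sqrt real_sqrt_divide)
qed

text \<open>\<open>rev\<close> reconciles two conventions: a tower puts the latest direction in
  front, \<open>bump_form\<close> the earliest. The power of \<open>1 / e\<close> comes from the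
  chain rule.\<close>

definition bump_tower :: "nat \<Rightarrow> nat \<Rightarrow> real \<Rightarrow> pnt \<Rightarrow> nat \<Rightarrow> pnt \<Rightarrow> mform" where
  "bump_tower d K e \<theta> j x hs = (1 / e) ^ j * bump_form d K 0 (rev hs) (rescale e \<theta> x)"

lemma bump_tower_has_derivative:
  assumes e: "0 < e" and j: "length hs = j" "j + 2 \<le> K"
  shows "((\<lambda>t. bump_tower d K e \<theta> j (vadd d x (vscale d t h)) hs) has_real_derivative
     bump_tower d K e \<theta> (Suc j) (vadd d x (vscale d t h)) (h # hs)) (at t)"
proof -
  let ?y = "\<lambda>t. rescale e \<theta> (vadd d x (vscale d t h))"
  let ?y' = "vscale d (1 / e) h"
  have 1: "((\<lambda>t. ip d (?y t) g) has_real_derivative ip d ?y' g) (at t)" for g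
  proof -
    have "ip d (?y t) g = (ip d x g - ip d \<theta> g + t * ip d h g) / e" for t
      by (simp add: ip_def rescale_def vadd_def vscale_def sum_divide_distrib sum_distrib_left algebra_simps
          flip: sum.distrib sum_subtractf add_divide_distrib diff_divide_distrib)
    moreover have "((\<lambda>t. (ip d x g - ip d \<theta> g + t * ip d h g) / e) has_real_derivative ip d h g / e) (at t)"
      using e by (auto intro!: derivative_eq_intros)
    ultimately show ?thesis by (simp add: ip_lin)
  qed
  have 2: "((\<lambda>t. ip d (?y t) (?y t)) has_real_derivative 2 * ip d (?y t) ?y') (at t)"
  proof -
    have c: "((\<lambda>t. ?y t i) has_real_derivative ?y' i) (at t)" if "i < d" for i
      using e that unfolding rescale_def vadd_def vscale_def
      by (auto intro!: derivative_eq_intros)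
    show ?thesis unfolding ip_def sum_distrib_left
      by (rule DERIV_sum, rule DERIV_cong, rule DERIV_mult[OF c c]) auto
  qed
  have "((\<lambda>t. bump_form d K 0 (rev hs) (?y t)) has_real_derivative
      bump_form d K 0 (rev hs @ [?y']) (?y t)) (at t)"
    by (rule bump_form_has_derivative[where y = ?y, OF 1 2]) (use j in simp)
  also have "bump_form d K 0 (rev hs @ [?y']) (?y t) = 1 / e * bump_form d K 0 (rev hs @ [h]) (?y t)"
    using bump_form_slot[of d ?y' "1/e" h 0 h "length hs" "rev hs @ [h]" K 0 "?y t"]
    by (simp add: ip_lin list_update_append)
  finally show ?thesis unfolding bump_tower_def
    by (intro DERIV_cong[OF DERIV_cmult]) auto
qed

lemma bump_tower_eq_0:
  assumes "0 < e" "j < K" "length hs = j" "e \<le> vnorm d (vdiff d x \<theta>)"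
  shows "bump_tower d K e \<theta> j x hs = 0"
proof -
  have "1 \<le> (vnorm d (rescale e \<theta> x))\<^sup>2" using assms by (simp add: vnorm_rescale)
  thus ?thesis using assms by (simp add: bump_tower_def bump_form_eq_0 vnorm_sq)
qed

text \<open>The bound on \<open>bump_form\<close> is available in the unit ball only; outside the
  rescaled ball the derivative is 0.\<close>

lemma bump_tower_bound:
  assumes B: "\<And>d hs y. length hs \<le> J \<Longrightarrow> vnorm d y \<le> 1 \<Longrightarrow> \<bar>bump_form d K 0 hs y\<bar> \<le> B * norm_prod d hs"
    and "0 < e" "j < K" "length hs = j" "j \<le> J" "1 \<le> B"
  shows "\<bar>bump_tower d K e \<theta> j x hs\<bar> \<le> (1 / e) ^ j * B * norm_prod d hs"
proof (cases "e \<le> vnorm d (vdiff d x \<theta>)")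
  case True
  thus ?thesis using assms by (simp add: bump_tower_eq_0)
next
  case False
  hence "vnorm d (rescale e \<theta> x) \<le> 1" using assms(2) by (simp add: vnorm_rescale)
  hence "\<bar>bump_form d K 0 (rev hs) (rescale e \<theta> x)\<bar> \<le> B * norm_prod d hs"
    using B[of "rev hs" d] assms by simp
  thus ?thesis using assms(2) by (simp add: bump_tower_def abs_mult mult_left_mono mult.assoc)
qed

text \<open>The exponent \<open>Suc J\<close> is what the condition \<open>j + 2 \<le> K\<close> of
  the differentiation rule demands for all \<open>j < J\<close>.\<close>

lemma deriv_tower_bump:
  assumes B: "\<And>d hs y. length hs \<le> J \<Longrightarrow> vnorm d y \<le> 1 \<Longrightarrow> \<bar>bump_form d (Suc J) 0 hs y\<bar> \<le> B * norm_prod d hs"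
    and e: "0 < e" "e \<le> 1" and B1: "1 \<le> B"
  shows "deriv_tower d J ((1 / e) ^ J * B) (bump_tower d (Suc J) e \<theta>)"
  unfolding deriv_tower_def
proof (intro conjI allI impI)
  fix j x assume "j \<le> J"
  show "multilinear_form d j (bump_tower d (Suc J) e \<theta> j x)"
    unfolding bump_tower_def[abs_def] by (rule multilinear_bump_form)
next
  fix j x h hs t assume "j < J" "x \<in> euc d \<and> h \<in> euc d \<and> hs \<in> forms d j"
  thus "((\<lambda>t. bump_tower d (Suc J) e \<theta> j (vadd d x (vscale d t h)) hs) has_real_derivative
     bump_tower d (Suc J) e \<theta> (Suc j) (vadd d x (vscale d t h)) (h # hs)) (at t)"
    by (intro bump_tower_has_derivative e) (auto simp: forms_def)
next
  fix j x hs assume j: "j \<le> J" and "x \<in> euc d \<and> hs \<in> forms d j"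
  hence "\<bar>bump_tower d (Suc J) e \<theta> j x hs\<bar> \<le> (1 / e) ^ j * B * norm_prod d hs"
    by (intro bump_tower_bound[OF B] e B1) (auto simp: forms_def)
  also have "\<dots> \<le> (1 / e) ^ J * B * norm_prod d hs"
    using e B1 j by (intro mult_right_mono power_increasing) auto
  finally show "\<bar>bump_tower d (Suc J) e \<theta> j x hs\<bar> \<le> (1 / e) ^ J * B * norm_prod d hs" .
qed

text \<open>The crude factor \<open>card S\<close> is harmless: this bound only certifies
  differentiability, while the size of the derivatives is controlled later through disjoint
  supports.\<close>

lemma deriv_tower_sum:
  assumes G: "\<And>\<theta>. \<theta> \<in> S \<Longrightarrow> deriv_tower d J B (G \<theta>)"
  shows "deriv_tower d J (\<bar>A\<bar> * (real (card S) * B)) (\<lambda>j x hs. A * (\<Sum>\<theta>\<in>S. G \<theta> j x hs))"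
  unfolding deriv_tower_def
proof (intro conjI allI impI)
  fix j x assume j: "j \<le> J"
  show "multilinear_form d j (\<lambda>hs. A * (\<Sum>\<theta>\<in>S. G \<theta> j x hs))"
    using deriv_tower_multilinear[OF G j]
    by (auto simp: multilinear_form_def sum.distrib sum_distrib_left algebra_simps)
next
  fix j x h hs t assume j: "j < J" "x \<in> euc d \<and> h \<in> euc d \<and> hs \<in> forms d j"
  show "((\<lambda>t. A * (\<Sum>\<theta>\<in>S. G \<theta> j (vadd d x (vscale d t h)) hs)) has_real_derivative
      A * (\<Sum>\<theta>\<in>S. G \<theta> (Suc j) (vadd d x (vscale d t h)) (h # hs))) (at t)"
    by (intro DERIV_cmult DERIV_sum deriv_tower_deriv[OF G]) (use j in auto)
next
  fix j x hs assume j: "j \<le> J" "x \<in> euc d \<and> hs \<in> forms d j"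
  have "\<bar>\<Sum>\<theta>\<in>S. G \<theta> j x hs\<bar> \<le> (\<Sum>\<theta>\<in>S. \<bar>G \<theta> j x hs\<bar>)" by (rule sum_abs)
  also have "\<dots> \<le> real (card S) * (B * norm_prod d hs)"
    by (rule sum_bounded_above) (use deriv_tower_bound[OF G] j in auto)
  finally show "\<bar>A * (\<Sum>\<theta>\<in>S. G \<theta> j x hs)\<bar> \<le> \<bar>A\<bar> * (real (card S) * B) * norm_prod d hs"
    by (simp add: abs_mult mult_left_mono mult.assoc)
qed

section \<open>Sums of bumps with disjoint supports\<close>

definition bump_sum :: "nat \<Rightarrow> nat \<Rightarrow> real \<Rightarrow> real \<Rightarrow> pnt set \<Rightarrow> pnt \<Rightarrow> real" where
  "bump_sum d K A e S x = A * (\<Sum>\<theta>\<in>S. max 0 (1 - (vnorm d (vdiff d x \<theta>) / e)\<^sup>2) ^ K)"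

definition separated :: "nat \<Rightarrow> real \<Rightarrow> pnt set \<Rightarrow> bool" where
  "separated d r S \<longleftrightarrow> (\<forall>\<theta>\<in>S. \<forall>\<theta>'\<in>S. \<theta> \<noteq> \<theta>' \<longrightarrow> r \<le> vnorm d (vdiff d \<theta> \<theta>'))"

lemma vnorm_vdiff_triangle: "vnorm d (vdiff d x z) \<le> vnorm d (vdiff d x y) + vnorm d (vdiff d y z)"
proof -
  have "vdiff d x z = vadd d (vdiff d x y) (vdiff d y z)"
    by (rule euc_eqI[of _ d], simp, simp) (simp add: vdiff_def vadd_def)
  thus ?thesis by (simp add: vnorm_vadd_le)
qed

lemma vnorm_vdiff_commute: "vnorm d (vdiff d x y) = vnorm d (vdiff d y x)"
  by (simp add: vnorm_eq_sqrt ip_def vdiff_def algebra_simps)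

lemma card_active_le_1:
  assumes "finite S" "separated d (2 * e) S"
  shows "card {\<theta>\<in>S. vnorm d (vdiff d x \<theta>) < e} \<le> 1"
proof -
  have "\<theta> = \<theta>'" if "\<theta> \<in> S" "\<theta>' \<in> S" "vnorm d (vdiff d x \<theta>) < e" "vnorm d (vdiff d x \<theta>') < e" for \<theta> \<theta>'
    using vnorm_vdiff_triangle[of d \<theta> \<theta>' x] assms(2) that
    unfolding separated_def vnorm_vdiff_commute[of d \<theta> x] by fastforce
  thus ?thesis using assms(1) by (simp add: card_le_Suc0_iff_eq)
qed

text \<open>Used with \<open>k = 1\<close> for a derivative at one point and with
  \<open>k = 2\<close> for a difference between two points.\<close>

lemma abs_sum_le_card_active:
  fixes g :: "'a \<Rightarrow> real"
  assumes "finite S" "T \<subseteq> S" "\<And>\<theta>. \<theta> \<in> S - T \<Longrightarrow> g \<theta> = 0" "\<And>\<theta>. \<theta> \<in> S \<Longrightarrow> \<bar>g \<theta>\<bar> \<le> b"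
    "card T \<le> k" "0 \<le> b"
  shows "\<bar>\<Sum>\<theta>\<in>S. g \<theta>\<bar> \<le> real k * b"
proof -
  have "(\<Sum>\<theta>\<in>S. g \<theta>) = (\<Sum>\<theta>\<in>T. g \<theta>)"
    by (rule sum.mono_neutral_right) (use assms in auto)
  also have "\<bar>\<dots>\<bar> \<le> (\<Sum>\<theta>\<in>T. \<bar>g \<theta>\<bar>)" by (rule sum_abs)
  also have "\<dots> \<le> real (card T) * b" by (rule sum_bounded_above) (use assms in auto)
  also have "\<dots> \<le> real k * b" using assms by (intro mult_right_mono) auto
  finally show ?thesis .
qed

text \<open>Interpolates between the trivial bound and the Lipschitz bound; the result is the Holder
  bound.\<close>

lemma min_le_powr:
  fixes t \<rho> :: real
  assumes "0 < t" "0 \<le> \<rho>" "\<rho> \<le> 1" 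
  shows "min 1 t \<le> t powr \<rho>"
proof (cases "t \<le> 1")
  case True
  hence "t powr 1 \<le> t powr \<rho>" using assms by (intro powr_mono') auto
  thus ?thesis using assms by simp
next
  case False
  thus ?thesis using ge_one_powr_ge_zero[of t \<rho>] assms by simp
qed

text \<open>Since the supports of the bumps are disjoint, at most one bump contributes to a derivative at a
  point and at most two to a difference of derivatives: the constant does not depend on \<open>card S\<close>.\<close>

lemma bump_sum_in_Cs_ball:
  assumes s: "s > 0"
  defines "m \<equiv> nat \<lfloor>s\<rfloor>"
  shows "\<exists>a>0. \<forall>d e S. 0 < e \<longrightarrow> e \<le> 1 \<longrightarrow> finite S \<longrightarrow> separated d (2 * e) S \<longrightarrow>
    bump_sum d (m + 2) (a * e powr s) e S \<in> Cs_ball d s"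
proof -
  obtain B where B: "B \<ge> 1" "\<And>d hs y. length hs \<le> Suc m \<Longrightarrow> vnorm d y \<le> 1 \<Longrightarrow>
      \<bar>bump_form d (Suc (Suc m)) 0 hs y\<bar> \<le> B * norm_prod d hs"
    using bump_form_bounded_uniform[of "Suc m" "Suc (Suc m)" 0] by auto
  \<comment> \<open>The 4 is 2 for the bumps that can be active at \<open>x\<close> or
    \<open>y\<close>, times 2 for the trivial bound on a difference of two derivatives.\<close>
  define a where "a = 1 / (4 * B)"
  have a: "0 < a" using B by (simp add: a_def)
  have sm: "s = real m + frac s" using s by (simp add: m_def frac_def)
  show ?thesis
  proof (intro exI[of _ a] conjI a allI impI)
    fix d e S assume e: "(0::real) < e" "e \<le> 1" and S: "finite S" "separated d (2 * e) S"
    define T where "T = bump_tower d (Suc (Suc m)) e"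
    \<comment> \<open>\<open>e ^ m\<close> cancels the loss \<open>(1 / e) ^ m\<close> from
      differentiation, and \<open>e powr frac s\<close> the loss from the Holder quotient at scale
      \<open>e\<close>.\<close>
    have es: "e powr s = e ^ m * e powr frac s"
      using e by (subst sm) (simp add: powr_add powr_realpow)
    have T: "deriv_tower d (Suc m) ((1 / e) ^ Suc m * B) (T \<theta>)" for \<theta>
      unfolding T_def by (rule deriv_tower_bump[OF B(2) e B(1)])
    define A where "A = a * e powr s"
    have A: "0 < A" using a e by (simp add: A_def)
    have Tb: "\<bar>T \<theta> j x hs\<bar> \<le> (1 / e) ^ m * B" if j: "j \<le> m" "hs \<in> unit_forms d j" for \<theta> j x hs
    proof -
      have "\<bar>T \<theta> j x hs\<bar> \<le> (1 / e) ^ j * B * norm_prod d hs" unfolding T_def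
        by (rule bump_tower_bound[OF B(2)]) (use e j B in \<open>auto simp: unit_forms_def\<close>)
      also have "\<dots> \<le> (1 / e) ^ m * B * 1" using e j B norm_prod_unit_le[OF j(2)]
        by (intro mult_mono power_increasing) auto
      finally show ?thesis by simp
    qed
    have T0: "T \<theta> j x hs = 0" if "j \<le> m" "hs \<in> unit_forms d j" "\<not> vnorm d (vdiff d x \<theta>) < e" for \<theta> j x hs
      unfolding T_def using that e by (intro bump_tower_eq_0) (auto simp: unit_forms_def)
    have Ae: "A * ((1 / e) ^ m * B) = e powr frac s / 4"
      using e B by (simp add: A_def a_def es field_simps)
    show "bump_sum d (m + 2) (a * e powr s) e S \<in> Cs_ball d s"
    proof (rule Cs_ball_tower[OF s])
      show "deriv_tower d (Suc (nat \<lfloor>s\<rfloor>)) (\<bar>A\<bar> * (real (card S) * ((1 / e) ^ Suc m * B)))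
          (\<lambda>j x hs. A * (\<Sum>\<theta>\<in>S. T \<theta> j x hs))"
        unfolding m_def[symmetric] by (rule deriv_tower_sum[OF T])
      show "0 \<le> \<bar>A\<bar> * (real (card S) * ((1 / e) ^ Suc m * B))" using B e by simp
      fix x assume "x \<in> euc d"
      show "bump_sum d (m + 2) (a * e powr s) e S x = A * (\<Sum>\<theta>\<in>S. T \<theta> 0 x [])"
        using e by (simp add: bump_sum_def A_def T_def bump_tower_def psi_def vnorm_sq[symmetric] vnorm_rescale)
    next
      fix j x hs assume "j \<le> nat \<lfloor>s\<rfloor>" and hs: "hs \<in> unit_forms d j"
      hence j: "j \<le> m" by (simp add: m_def)
      have "\<bar>\<Sum>\<theta>\<in>S. T \<theta> j x hs\<bar> \<le> real 1 * ((1 / e) ^ m * B)"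
        by (rule abs_sum_le_card_active[where T = "{\<theta>\<in>S. vnorm d (vdiff d x \<theta>) < e}"])
           (use S card_active_le_1[OF S] T0[OF j hs] Tb[OF j hs] e B in auto)
      hence "\<bar>A * (\<Sum>\<theta>\<in>S. T \<theta> j x hs)\<bar> \<le> A * ((1 / e) ^ m * B)"
        using A by (simp add: abs_mult)
      also have "\<dots> \<le> 1" unfolding Ae using e powr_le1[of "frac s" e] by (simp add: frac_ge_0)
      finally show "\<bar>A * (\<Sum>\<theta>\<in>S. T \<theta> j x hs)\<bar> \<le> 1" .
    next
      fix x y hs assume x: "x \<in> euc d" and y: "y \<in> euc d" and "hs \<in> unit_forms d (nat \<lfloor>s\<rfloor>)"
      hence hs: "hs \<in> unit_forms d m" by (simp add: m_def)
      let ?v = "vnorm d (vdiff d x y)"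
      have lip: "\<bar>T \<theta> m x hs - T \<theta> m y hs\<bar> \<le> (1 / e) ^ m * B * (?v / e)" for \<theta>
      proof -
        have "\<bar>T \<theta> m x hs - T \<theta> m y hs\<bar> \<le> (1 / e) ^ Suc m * B * ?v * norm_prod d hs"
          by (rule deriv_tower_lipschitz[OF T lessI x y unit_formsD[OF hs]])
        also have "\<dots> \<le> (1 / e) ^ Suc m * B * ?v * 1"
          using e B norm_prod_unit_le[OF hs] by (intro mult_left_mono) auto
        finally show ?thesis by (simp add: algebra_simps)
      qed
      have diff: "\<bar>T \<theta> m x hs - T \<theta> m y hs\<bar> \<le> (1 / e) ^ m * B * (2 * (?v / e) powr frac s)" for \<theta>
      proof (cases "?v = 0")
        case True
        thus ?thesis using lip[of \<theta>] by simp
      next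
        case False
        hence v: "0 < ?v / e" using e by (simp add: order_less_le)
        have "\<bar>T \<theta> m x hs - T \<theta> m y hs\<bar> \<le> (1 / e) ^ m * B * 2"
          using Tb[OF order_refl hs, of \<theta> x] Tb[OF order_refl hs, of \<theta> y] by linarith
        hence "\<bar>T \<theta> m x hs - T \<theta> m y hs\<bar> \<le> (1 / e) ^ m * B * (2 * min 1 (?v / e))"
          using lip[of \<theta>] mult_left_mono[of "?v / e" "2 * (?v / e)" "(1 / e) ^ m * B"] v e B
          by (auto simp: min_def simp del: times_divide_eq_right intro: order_trans)
        also have "\<dots> \<le> (1 / e) ^ m * B * (2 * (?v / e) powr frac s)"
          using e B min_le_powr[OF v frac_ge_0[of s]] frac_lt_1[of s] by (intro mult_left_mono) auto
        finally show ?thesis .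
      qed
      have "\<bar>\<Sum>\<theta>\<in>S. T \<theta> m x hs - T \<theta> m y hs\<bar> \<le> real 2 * ((1 / e) ^ m * B * (2 * (?v / e) powr frac s))"
      proof (rule abs_sum_le_card_active[where T = "{\<theta>\<in>S. vnorm d (vdiff d x \<theta>) < e} \<union> {\<theta>\<in>S. vnorm d (vdiff d y \<theta>) < e}"])
        show "card ({\<theta>\<in>S. vnorm d (vdiff d x \<theta>) < e} \<union> {\<theta>\<in>S. vnorm d (vdiff d y \<theta>) < e}) \<le> 2"
          using card_active_le_1[OF S, of x] card_active_le_1[OF S, of y]
          by (intro order_trans[OF card_Un_le]) linarith
      qed (use S T0[OF order_refl hs] diff e B in auto)
      hence "A * \<bar>\<Sum>\<theta>\<in>S. T \<theta> m x hs - T \<theta> m y hs\<bar> \<le> A * (2 * ((1 / e) ^ m * B * (2 * (?v / e) powr frac s)))"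
        using A by (intro mult_left_mono) auto
      also have "\<dots> = (A * ((1 / e) ^ m * B)) * (4 * (?v / e) powr frac s)" by (simp add: algebra_simps)
      also have "\<dots> = ?v powr frac s" unfolding Ae using e by (simp add: powr_divide)
      finally show "\<bar>A * (\<Sum>\<theta>\<in>S. T \<theta> (nat \<lfloor>s\<rfloor>) x hs) - A * (\<Sum>\<theta>\<in>S. T \<theta> (nat \<lfloor>s\<rfloor>) y hs)\<bar> \<le> ?v powr frac s"
        using A unfolding m_def[symmetric] by (simp add: sum_subtractf abs_mult flip: right_diff_distrib)
    qed
  qed
qed

section \<open>Bayes risk over a finite set of parameters\<close>

text \<open>The density of \<open>gaussian d \<theta> \<sigma>\<close> relative to the centred
  Gaussian. With this common reference measure all posterior quantities become integrals over
  it.\<close>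

definition lik :: "nat \<Rightarrow> real \<Rightarrow> pnt \<Rightarrow> pnt \<Rightarrow> real" where
  "lik d \<sigma> \<theta> x = exp (ip d \<theta> x / \<sigma>\<^sup>2 - ip d \<theta> \<theta> / (2 * \<sigma>\<^sup>2))"

lemma lik_pos: "0 < lik d \<sigma> \<theta> x"
  by (simp add: lik_def)

lemma sets_gaussian: "sets (gaussian d \<theta> \<sigma>) = sets (\<Pi>\<^sub>M i\<in>{..<d}. (borel :: real measure))"
  unfolding gaussian_def by (rule sets_PiM_cong) auto

lemma borel_measurable_gaussian:
  "f \<in> borel_measurable (gaussian d \<theta> \<sigma>) \<longleftrightarrow> f \<in> borel_measurable (\<Pi>\<^sub>M i\<in>{..<d}. (borel :: real measure))"
  by (simp add: measurable_cong_sets[OF sets_gaussian refl])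

lemma borel_measurable_lik [measurable]: "lik d \<sigma> \<theta> \<in> borel_measurable (gaussian d \<theta>' \<sigma>')"
  unfolding borel_measurable_gaussian lik_def[abs_def] ip_def by measurable

lemma prob_space_gaussian: "\<sigma> > 0 \<Longrightarrow> prob_space (gaussian d \<theta> \<sigma>)"
  unfolding gaussian_def by (intro prob_space_PiM prob_space_normal_density)

lemma normal_density_shift:
  assumes "\<sigma> > 0"
  shows "density lborel (normal_density \<mu> \<sigma>) =
    density (density lborel (normal_density 0 \<sigma>)) (\<lambda>x. ennreal (exp (\<mu> * x / \<sigma>\<^sup>2 - \<mu> * \<mu> / (2 * \<sigma>\<^sup>2))))"
proof -
  have "normal_density \<mu> \<sigma> x = normal_density 0 \<sigma> x * exp (\<mu> * x / \<sigma>\<^sup>2 - \<mu> * \<mu> / (2 * \<sigma>\<^sup>2))" for x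
  proof -
    have "- (x - \<mu>)\<^sup>2 / (2 * \<sigma>\<^sup>2) = - x\<^sup>2 / (2 * \<sigma>\<^sup>2) + (\<mu> * x / \<sigma>\<^sup>2 - \<mu> * \<mu> / (2 * \<sigma>\<^sup>2))"
      using assms by (simp add: field_simps power2_eq_square)
    thus ?thesis by (simp add: normal_density_def flip: exp_add)
  qed
  thus ?thesis by (subst density_density_eq) (auto simp: ennreal_mult)
qed

text \<open>A product measure is determined by its values on boxes, and there the density factors
  into one-dimensional shifts.\<close>

lemma gaussian_eq_density:
  assumes \<sigma>: "\<sigma> > 0"
  shows "gaussian d \<theta> \<sigma> = density (gaussian d (vzero d) \<sigma>) (\<lambda>x. ennreal (lik d \<sigma> \<theta> x))"
proof -
  define M where "M = (\<lambda>i. density lborel (\<lambda>x. ennreal (normal_density (\<theta> i) \<sigma> x)))"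
  define N where "N = (\<lambda>i::nat. density lborel (\<lambda>x. ennreal (normal_density 0 \<sigma> x)))"
  interpret M: product_prob_space M
    unfolding M_def product_prob_space_def product_prob_space_axioms_def product_sigma_finite_def
    using prob_space_normal_density[OF \<sigma>] by (auto intro: prob_space_imp_sigma_finite)
  interpret N: product_prob_space N
    unfolding N_def product_prob_space_def product_prob_space_axioms_def product_sigma_finite_def
    using prob_space_normal_density[OF \<sigma>] by (auto intro: prob_space_imp_sigma_finite)
  have N: "gaussian d (vzero d) \<sigma> = PiM {..<d} N"
    unfolding gaussian_def N_def by (rule PiM_cong) (auto simp: vzero_def)
  define l where "l = (\<lambda>i x. ennreal (exp (\<theta> i * x / \<sigma>\<^sup>2 - \<theta> i * \<theta> i / (2 * \<sigma>\<^sup>2))))"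
  have [measurable]: "l i \<in> borel_measurable borel" for i unfolding l_def by measurable
  have sN: "sets (N i) = sets borel" for i by (simp add: N_def)
  have lik: "ennreal (lik d \<sigma> \<theta> x) = (\<Prod>i<d. l i (x i))" for x
  proof -
    have "lik d \<sigma> \<theta> x = (\<Prod>i<d. exp (\<theta> i * x i / \<sigma>\<^sup>2 - \<theta> i * \<theta> i / (2 * \<sigma>\<^sup>2)))"
      by (simp add: lik_def ip_def sum_divide_distrib sum_subtractf flip: exp_sum)
    thus ?thesis by (simp add: l_def prod_ennreal)
  qed
  have "density (PiM {..<d} N) (\<lambda>x. ennreal (lik d \<sigma> \<theta> x)) = PiM {..<d} M"
  proof (rule M.PiM_eqI)
    show "sets (density (PiM {..<d} N) (\<lambda>x. ennreal (lik d \<sigma> \<theta> x))) = sets (PiM {..<d} M)"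
      by (auto simp: M_def N_def intro!: sets_PiM_cong)
    fix A assume "\<And>i. i \<in> {..<d} \<Longrightarrow> A i \<in> sets (M i)"
    hence A: "\<And>i. i \<in> {..<d} \<Longrightarrow> A i \<in> sets borel" by (simp add: M_def)
    have PA: "Pi\<^sub>E {..<d} A \<in> sets (PiM {..<d} N)"
      by (rule sets_PiM_I_finite) (use A sN in auto)
    have "emeasure (density (PiM {..<d} N) (\<lambda>x. ennreal (lik d \<sigma> \<theta> x))) (Pi\<^sub>E {..<d} A) =
        (\<integral>\<^sup>+x. ennreal (lik d \<sigma> \<theta> x) * indicator (Pi\<^sub>E {..<d} A) x \<partial>PiM {..<d} N)"
      by (rule emeasure_density[OF _ PA])
         (use borel_measurable_lik[of d \<sigma> \<theta> "vzero d" \<sigma>] in \<open>simp add: N\<close>)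
    also have "\<dots> = (\<integral>\<^sup>+x. (\<Prod>i<d. l i (x i) * indicator (A i) (x i)) \<partial>PiM {..<d} N)"
    proof (rule nn_integral_cong)
      fix x assume "x \<in> space (PiM {..<d} N)"
      \<comment> \<open>Extensionality reduces membership in the box to the coordinates below
        \<open>d\<close>.\<close>
      hence "x \<in> extensional {..<d}" by (simp add: space_PiM PiE_iff)
      hence "indicator (Pi\<^sub>E {..<d} A) x = (\<Prod>i<d. indicator (A i) (x i) :: ennreal)"
        by (cases "\<forall>i<d. x i \<in> A i") (auto simp: indicator_def PiE_iff intro!: prod.neutral[symmetric])
      thus "ennreal (lik d \<sigma> \<theta> x) * indicator (Pi\<^sub>E {..<d} A) x = (\<Prod>i<d. l i (x i) * indicator (A i) (x i))"
        by (simp add: lik prod.distrib)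
    qed
    also have "\<dots> = (\<Prod>i<d. \<integral>\<^sup>+x. l i x * indicator (A i) x \<partial>N i)"
      by (rule N.product_nn_integral_prod) (use A in \<open>auto simp: N_def\<close>)
    also have "\<dots> = (\<Prod>i<d. emeasure (M i) (A i))"
    proof (rule prod.cong[OF refl])
      fix i assume i: "i \<in> {..<d}"
      have "M i = density (N i) (l i)"
        unfolding M_def N_def l_def by (rule normal_density_shift[OF \<sigma>])
      thus "(\<integral>\<^sup>+x. l i x * indicator (A i) x \<partial>N i) = emeasure (M i) (A i)"
        using A[OF i] by (simp add: emeasure_density N_def)
    qed
    finally show "emeasure (density (PiM {..<d} N) (\<lambda>x. ennreal (lik d \<sigma> \<theta> x))) (Pi\<^sub>E {..<d} A) =
       (\<Prod>i<d. emeasure (M i) (A i))" .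
  qed simp
  thus ?thesis unfolding N by (simp add: gaussian_def M_def)
qed

lemma nn_integral_lik:
  assumes \<sigma>: "\<sigma> > 0"
  shows "(\<integral>\<^sup>+x. ennreal (lik d \<sigma> \<theta> x) \<partial>gaussian d (vzero d) \<sigma>) = 1"
proof -
  interpret prob_space "gaussian d \<theta> \<sigma>" by (rule prob_space_gaussian[OF \<sigma>])
  have "1 = emeasure (gaussian d \<theta> \<sigma>) (space (gaussian d \<theta> \<sigma>))" by (simp add: emeasure_space_1)
  also have "\<dots> = (\<integral>\<^sup>+x. ennreal (lik d \<sigma> \<theta> x) \<partial>gaussian d (vzero d) \<sigma>)"
    unfolding gaussian_eq_density[OF \<sigma>, of d \<theta>]
    by (subst emeasure_density) (auto intro!: nn_integral_cong)
  finally show ?thesis by simp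
qed

lemma
  assumes \<sigma>: "\<sigma> > 0"
  shows integrable_lik: "integrable (gaussian d (vzero d) \<sigma>) (lik d \<sigma> \<theta>)"
    and integral_lik: "(\<integral>x. lik d \<sigma> \<theta> x \<partial>gaussian d (vzero d) \<sigma>) = 1"
proof -
  have "has_bochner_integral (gaussian d (vzero d) \<sigma>) (lik d \<sigma> \<theta>) 1"
    by (rule has_bochner_integral_nn_integral)
       (auto simp: borel_measurable_lik nn_integral_lik[OF \<sigma>] less_imp_le[OF lik_pos])
  thus "integrable (gaussian d (vzero d) \<sigma>) (lik d \<sigma> \<theta>)" "(\<integral>x. lik d \<sigma> \<theta> x \<partial>gaussian d (vzero d) \<sigma>) = 1"
    by (auto simp: has_bochner_integral_iff)
qed

text \<open>The squared likelihood ratio is proportional to the ratio at the doubled mean, so its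
  integral, 1 plus the chi-square divergence from the centre, is read off from
  \<open>integral_lik\<close>.\<close>

lemma lik_sq: "\<sigma> > 0 \<Longrightarrow> (lik d \<sigma> \<theta> x)\<^sup>2 = exp (ip d \<theta> \<theta> / \<sigma>\<^sup>2) * lik d \<sigma> (vscale d 2 \<theta>) x"
  by (simp add: lik_def ip_lin ip_commute[of d \<theta> "vscale d 2 \<theta>"] power2_eq_square field_simps
      flip: exp_add)

lemma
  assumes \<sigma>: "\<sigma> > 0"
  shows integrable_lik_sq: "integrable (gaussian d (vzero d) \<sigma>) (\<lambda>x. (lik d \<sigma> \<theta> x)\<^sup>2)"
    and integral_lik_sq: "(\<integral>x. (lik d \<sigma> \<theta> x)\<^sup>2 \<partial>gaussian d (vzero d) \<sigma>) = exp (ip d \<theta> \<theta> / \<sigma>\<^sup>2)"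
  by (simp_all add: lik_sq[OF \<sigma>] integrable_lik[OF \<sigma>] integral_lik[OF \<sigma>])

lemma sq_risk_eq:
  assumes \<sigma>: "\<sigma> > 0" and T: "T \<in> estimators d"
  shows "sq_risk d \<sigma> f T \<theta> =
    (\<integral>\<^sup>+x. ennreal (lik d \<sigma> \<theta> x * (T x - f \<theta>)\<^sup>2) \<partial>gaussian d (vzero d) \<sigma>)"
proof -
  have "T \<in> borel_measurable (gaussian d (vzero d) \<sigma>)"
    using T by (simp add: estimators_def borel_measurable_gaussian)
  thus ?thesis
    unfolding sq_risk_def gaussian_eq_density[OF \<sigma>, of d \<theta>]
    by (subst nn_integral_density)
       (auto simp: borel_measurable_lik ennreal_mult less_imp_le[OF lik_pos])
qed

text \<open>The posterior variance identity, with the mean replaced by an arbitrary \<open>t\<close>.\<close>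

lemma sum_weighted_square_ge:
  fixes p v :: "'a \<Rightarrow> real"
  assumes "0 < (\<Sum>i\<in>I. p i)"
  shows "(\<Sum>i\<in>I. \<Sum>j\<in>I. (v i - v j)\<^sup>2 / 2 * (p i * p j / (\<Sum>i\<in>I. p i))) \<le> (\<Sum>i\<in>I. p i * (t - v i)\<^sup>2)"
proof -
  define Z where "Z = (\<Sum>i\<in>I. p i)"
  define m1 where "m1 = (\<Sum>i\<in>I. p i * (t - v i))"
  define m2 where "m2 = (\<Sum>i\<in>I. p i * (t - v i)\<^sup>2)"
  have eq: "m2 * Z + Z * m2 - 2 * (m1 * m1) = (\<Sum>i\<in>I. \<Sum>j\<in>I. (p i * (t - v i)\<^sup>2) * p j)
      + (\<Sum>i\<in>I. \<Sum>j\<in>I. p i * (p j * (t - v j)\<^sup>2))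
      - 2 * (\<Sum>i\<in>I. \<Sum>j\<in>I. (p i * (t - v i)) * (p j * (t - v j)))"
    unfolding m1_def m2_def Z_def sum_product ..
  have "(\<Sum>i\<in>I. \<Sum>j\<in>I. (v i - v j)\<^sup>2 * (p i * p j)) =
      (\<Sum>i\<in>I. \<Sum>j\<in>I. (p i * (t - v i)\<^sup>2) * p j + p i * (p j * (t - v j)\<^sup>2)
         - 2 * ((p i * (t - v i)) * (p j * (t - v j))))"
    by (intro sum.cong refl) (simp add: power2_eq_square algebra_simps)
  also have "\<dots> = m2 * Z + Z * m2 - 2 * (m1 * m1)"
    unfolding eq by (simp only: sum.distrib sum_subtractf sum_distrib_left)
  \<comment> \<open>The dropped term \<open>m1 * m1\<close> vanishes when \<open>t\<close> is the
    weighted mean.\<close>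
  also have "\<dots> \<le> 2 * (m2 * Z)" by (simp add: mult.commute)
  finally have "(\<Sum>i\<in>I. \<Sum>j\<in>I. (v i - v j)\<^sup>2 * (p i * p j)) / (2 * Z) \<le> m2"
    using assms by (simp add: Z_def field_simps)
  moreover have "(\<Sum>i\<in>I. \<Sum>j\<in>I. (v i - v j)\<^sup>2 / 2 * (p i * p j / Z)) =
     (\<Sum>i\<in>I. \<Sum>j\<in>I. (v i - v j)\<^sup>2 * (p i * p j)) / (2 * Z)"
    by (simp add: sum_divide_distrib)
  ultimately show ?thesis by (simp add: Z_def m2_def)
qed

lemma integral_double_sum:
  fixes h :: "'b \<Rightarrow> 'c \<Rightarrow> 'a \<Rightarrow> real"
  assumes "\<And>i j. i \<in> I \<Longrightarrow> j \<in> J \<Longrightarrow> integrable M (h i j)"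
  shows "(\<integral>x. (\<Sum>i\<in>I. \<Sum>j\<in>J. c i j * h i j x) \<partial>M) = (\<Sum>i\<in>I. \<Sum>j\<in>J. c i j * (\<integral>x. h i j x \<partial>M))"
  using assms by (simp add: Bochner_Integration.integral_sum Bochner_Integration.integrable_sum)

text \<open>Up to the factor \<open>card I\<close>, \<open>pair_weight d \<sigma> I i j\<close> is the probability that \<open>i\<close> is the true
  parameter under the uniform prior on \<open>I\<close> while \<open>j\<close> is drawn from the posterior.  The bound on the
  diagonal is a chi-square version of Fano's inequality.\<close>

definition pair_weight :: "nat \<Rightarrow> real \<Rightarrow> pnt set \<Rightarrow> pnt \<Rightarrow> pnt \<Rightarrow> real" where
  "pair_weight d \<sigma> I i j =
     (\<integral>x. lik d \<sigma> i x * lik d \<sigma> j x / (\<Sum>k\<in>I. lik d \<sigma> k x) \<partial>gaussian d (vzero d) \<sigma>)"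

lemma
  assumes \<sigma>: "\<sigma> > 0" and I: "finite I" "I \<noteq> {}"
  shows pair_weight_commute: "pair_weight d \<sigma> I i j = pair_weight d \<sigma> I j i"
    and pair_weight_nonneg: "0 \<le> pair_weight d \<sigma> I i j"
    and sum_pair_weight: "(\<Sum>i\<in>I. \<Sum>j\<in>I. pair_weight d \<sigma> I i j) = real (card I)"
    and sum_pair_weight_diag_le:
      "(\<Sum>i\<in>I. pair_weight d \<sigma> I i i) \<le> sqrt (\<Sum>i\<in>I. exp (ip d i i / \<sigma>\<^sup>2))"
    and sum_sq_risk_ge: "T \<in> estimators d \<Longrightarrow>
       ennreal (\<Sum>i\<in>I. \<Sum>j\<in>I. (f i - f j)\<^sup>2 / 2 * pair_weight d \<sigma> I i j) \<le> (\<Sum>i\<in>I. sq_risk d \<sigma> f T i)"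
proof -
  let ?M = "gaussian d (vzero d) \<sigma>"
  let ?L = "lik d \<sigma>"
  define Z where "Z x = (\<Sum>i\<in>I. ?L i x)" for x
  have Z: "0 < Z x" for x unfolding Z_def by (rule sum_pos[OF I]) (rule lik_pos)
  have Zm[measurable]: "Z \<in> borel_measurable ?M"
    unfolding Z_def[abs_def] by (intro borel_measurable_sum borel_measurable_lik)
  note [measurable] = borel_measurable_lik[of d \<sigma> _ "vzero d" \<sigma>]
  define q where "q = pair_weight d \<sigma> I"
  have q_eq: "q i j = (\<integral>x. ?L i x * ?L j x / Z x \<partial>?M)" for i j
    by (simp add: q_def pair_weight_def Z_def)
  \<comment> \<open>\<open>?L j x / Z x\<close> is a posterior weight, at most 1, so
    \<open>?L i\<close> dominates.\<close>
  have int: "integrable ?M (\<lambda>x. ?L i x * ?L j x / Z x)" if "j \<in> I" for i j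
  proof (rule Bochner_Integration.integrable_bound[OF integrable_lik[OF \<sigma>, of d i]])
    show "AE x in ?M. norm (?L i x * ?L j x / Z x) \<le> norm (?L i x)"
    proof (rule AE_I2)
      fix x
      have "?L j x \<le> Z x" unfolding Z_def
        by (rule member_le_sum) (use that I in \<open>auto simp: less_imp_le[OF lik_pos]\<close>)
      thus "norm (?L i x * ?L j x / Z x) \<le> norm (?L i x)"
        using Z[of x] mult_left_mono[of "?L j x" "Z x" "?L i x"]
        by (simp add: abs_mult abs_of_pos lik_pos divide_le_eq less_imp_le[OF lik_pos])
    qed
  qed measurable
  show "pair_weight d \<sigma> I i j = pair_weight d \<sigma> I j i" by (simp add: q_eq mult.commute flip: q_def)
  show "0 \<le> pair_weight d \<sigma> I i j"
    unfolding q_def[symmetric] q_eq by (rule Bochner_Integration.integral_nonneg)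
      (simp add: less_imp_le[OF Z] less_imp_le[OF lik_pos])
  have "(\<Sum>i\<in>I. \<Sum>j\<in>I. q i j) = (\<integral>x. (\<Sum>i\<in>I. \<Sum>j\<in>I. ?L i x * ?L j x / Z x) \<partial>?M)"
    unfolding q_eq using int by (simp add: Bochner_Integration.integral_sum)
  also have "(\<lambda>x. \<Sum>i\<in>I. \<Sum>j\<in>I. ?L i x * ?L j x / Z x) = Z"
  proof
    fix x
    have "(\<Sum>i\<in>I. \<Sum>j\<in>I. ?L i x * ?L j x / Z x) = Z x * Z x / Z x"
      by (simp add: Z_def sum_product flip: sum_divide_distrib)
    thus "(\<Sum>i\<in>I. \<Sum>j\<in>I. ?L i x * ?L j x / Z x) = Z x" using Z[of x] by simp
  qed
  also have "(\<integral>x. Z x \<partial>?M) = real (card I)"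
    unfolding Z_def using integrable_lik[OF \<sigma>] integral_lik[OF \<sigma>]
    by (simp add: Bochner_Integration.integral_sum)
  finally show "(\<Sum>i\<in>I. \<Sum>j\<in>I. pair_weight d \<sigma> I i j) = real (card I)" by (simp add: q_def)
  show "(\<Sum>i\<in>I. pair_weight d \<sigma> I i i) \<le> sqrt (\<Sum>i\<in>I. exp (ip d i i / \<sigma>\<^sup>2))"
  proof -
    define D where "D = sqrt (\<Sum>i\<in>I. exp (ip d i i / \<sigma>\<^sup>2))"
    have D: "0 < D" unfolding D_def using I by (simp add: sum_pos)
    have D2: "(\<Sum>i\<in>I. exp (ip d i i / \<sigma>\<^sup>2)) = D\<^sup>2" by (simp add: D_def sum_nonneg)
    \<comment> \<open>\<open>Z\<close> dominates the Euclidean norm \<open>sqrt W\<close> of the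
      likelihoods, and the inequality of the means at scale \<open>D\<close> replaces Jensen's
      inequality: \<open>W\<close> has integral \<open>D^2\<close>, so the right side integrates to
      \<open>D\<close>.\<close>
    have pt: "(\<Sum>i\<in>I. ?L i x * ?L i x / Z x) \<le> (\<Sum>i\<in>I. (?L i x)\<^sup>2) / (2 * D) + D / 2" for x
    proof -
      define W where "W = (\<Sum>i\<in>I. (?L i x)\<^sup>2)"
      have W0: "0 \<le> W" unfolding W_def by (simp add: sum_nonneg)
      have "W \<le> (\<Sum>i\<in>I. ?L i x * Z x)" unfolding W_def power2_eq_square Z_def
        using I by (intro sum_mono mult_left_mono member_le_sum) (auto simp: less_imp_le[OF lik_pos])
      also have "\<dots> = (Z x)\<^sup>2" by (simp add: Z_def power2_eq_square sum_distrib_right)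
      finally have WZ: "sqrt W \<le> Z x" using Z[of x] by (simp add: real_le_lsqrt)
      have "(\<Sum>i\<in>I. ?L i x * ?L i x / Z x) = W / Z x"
        by (simp add: W_def power2_eq_square sum_divide_distrib)
      also have "\<dots> = sqrt W * sqrt W / Z x" using W0 by simp
      also have "\<dots> \<le> sqrt W * Z x / Z x"
        using WZ W0 Z[of x] by (intro divide_right_mono mult_left_mono) auto
      also have "\<dots> = sqrt W" using Z[of x] by simp
      also have "\<dots> \<le> W / (2 * D) + D / 2"
      proof -
        have "0 \<le> (sqrt W - D)\<^sup>2" by simp
        also have "\<dots> = W + D\<^sup>2 - 2 * D * sqrt W" using W0 by (simp add: power2_diff)
        finally show ?thesis using D by (simp add: field_simps power2_eq_square)
      qed
      finally show ?thesis by (simp add: W_def)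
    qed
    have "(\<Sum>i\<in>I. q i i) = (\<integral>x. (\<Sum>i\<in>I. ?L i x * ?L i x / Z x) \<partial>?M)"
      unfolding q_eq using int by (simp add: Bochner_Integration.integral_sum)
    also have "\<dots> \<le> (\<integral>x. (\<Sum>i\<in>I. (?L i x)\<^sup>2) / (2 * D) + D / 2 \<partial>?M)"
    proof (rule integral_mono)
      interpret prob_space ?M by (rule prob_space_gaussian[OF \<sigma>])
      show "integrable ?M (\<lambda>x. (\<Sum>i\<in>I. (?L i x)\<^sup>2) / (2 * D) + D / 2)"
        using integrable_lik_sq[OF \<sigma>] by auto
    qed (use int pt in auto)
    also have "\<dots> = D\<^sup>2 / (2 * D) + D / 2"
    proof -
      interpret prob_space ?M by (rule prob_space_gaussian[OF \<sigma>])
      show ?thesis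
        using integrable_lik_sq[OF \<sigma>] integral_lik_sq[OF \<sigma>]
        by (subst Bochner_Integration.integral_add) (auto simp: Bochner_Integration.integral_sum D2 prob_space)
    qed
    also have "\<dots> = D" using D by (simp add: power2_eq_square)
    finally show ?thesis by (simp add: D_def q_def)
  qed
  show "ennreal (\<Sum>i\<in>I. \<Sum>j\<in>I. (f i - f j)\<^sup>2 / 2 * pair_weight d \<sigma> I i j) \<le> (\<Sum>i\<in>I. sq_risk d \<sigma> f T i)"
    if T: "T \<in> estimators d"
  proof -
    have Tm[measurable]: "T \<in> borel_measurable ?M"
      using T by (simp add: estimators_def borel_measurable_gaussian)
    let ?g = "\<lambda>x. \<Sum>i\<in>I. \<Sum>j\<in>I. (f i - f j)\<^sup>2 / 2 * (?L i x * ?L j x / Z x)"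
    have gi: "integrable ?M ?g"
      by (intro Bochner_Integration.integrable_sum integrable_mult_right int)
    have eq: "(\<Sum>i\<in>I. \<Sum>j\<in>I. (f i - f j)\<^sup>2 / 2 * q i j) = (\<integral>x. ?g x \<partial>?M)"
      unfolding q_eq by (rule integral_double_sum[symmetric]) (rule int)
    have "ennreal (\<Sum>i\<in>I. \<Sum>j\<in>I. (f i - f j)\<^sup>2 / 2 * q i j) = (\<integral>\<^sup>+x. ennreal (?g x) \<partial>?M)"
      unfolding eq
    proof (rule nn_integral_eq_integral[OF gi, symmetric], rule AE_I2)
      fix x show "0 \<le> ?g x"
        by (intro sum_nonneg mult_nonneg_nonneg divide_nonneg_pos Z less_imp_le[OF lik_pos]) auto
    qed
    also have "\<dots> \<le> (\<integral>\<^sup>+x. ennreal (\<Sum>i\<in>I. ?L i x * (T x - f i)\<^sup>2) \<partial>?M)"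
    proof (rule nn_integral_mono, rule ennreal_leI)
      fix x show "?g x \<le> (\<Sum>i\<in>I. ?L i x * (T x - f i)\<^sup>2)"
        using sum_weighted_square_ge[where I = I and p = "\<lambda>i. ?L i x" and v = f and t = "T x"] Z[of x] by (simp add: Z_def)
    qed
    also have "\<dots> = (\<integral>\<^sup>+x. (\<Sum>i\<in>I. ennreal (?L i x * (T x - f i)\<^sup>2)) \<partial>?M)"
      by (simp add: sum_ennreal less_imp_le[OF lik_pos])
    also have "\<dots> = (\<Sum>i\<in>I. \<integral>\<^sup>+x. ennreal (?L i x * (T x - f i)\<^sup>2) \<partial>?M)"
      by (rule nn_integral_sum) measurable
    finally show ?thesis by (simp add: sq_risk_eq[OF \<sigma> T] q_def)
  qed
qed

text \<open>The factor 4 arises because \<open>S\<close> cuts half of the weight and the double sum counts every pair twice.\<close>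

lemma max_cut:
  fixes q :: "'a \<Rightarrow> 'a \<Rightarrow> real"
  assumes "finite I" "\<And>i j. q i j = q j i" "\<And>i j. 0 \<le> q i j"
  shows "\<exists>S\<subseteq>I. (\<Sum>i\<in>I. \<Sum>j\<in>I. q i j) - (\<Sum>i\<in>I. q i i) \<le> 4 * (\<Sum>i\<in>S. \<Sum>j\<in>I - S. q i j)"
  using assms(1)
proof induction
  case (insert x F)
  then obtain S where S: "S \<subseteq> F"
    "(\<Sum>i\<in>F. \<Sum>j\<in>F. q i j) - (\<Sum>i\<in>F. q i i) \<le> 4 * (\<Sum>i\<in>S. \<Sum>j\<in>F - S. q i j)" by blast
  have fin: "finite S" "finite (F - S)" using S(1) insert.hyps finite_subset by auto
  have xS: "x \<notin> S" using S insert.hyps by auto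
  have sym: "(\<Sum>i\<in>F'. q i x) = (\<Sum>i\<in>F'. q x i)" for F'
    by (intro sum.cong refl assms(2))
  have tot: "(\<Sum>i\<in>insert x F. \<Sum>j\<in>insert x F. q i j) - (\<Sum>i\<in>insert x F. q i i) =
     (\<Sum>i\<in>F. \<Sum>j\<in>F. q i j) - (\<Sum>i\<in>F. q i i) + 2 * (\<Sum>j\<in>F. q x j)"
    using insert.hyps by (simp add: sum.distrib sym)
  have split: "(\<Sum>j\<in>F. q x j) = (\<Sum>j\<in>S. q x j) + (\<Sum>j\<in>F - S. q x j)"
    using sum.subset_diff[OF S(1) insert.hyps(1), of "q x"] by simp
  show ?case
  \<comment> \<open>Greedy choice: \<open>x\<close> joins the side to which it is less strongly
    tied, so at least half of its weight to \<open>F\<close> is cut.\<close>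
  proof (cases "(\<Sum>j\<in>S. q x j) \<ge> (\<Sum>j\<in>F - S. q x j)")
    case True
    have "insert x F - S = insert x (F - S)" using xS by auto
    hence "(\<Sum>i\<in>S. \<Sum>j\<in>insert x F - S. q i j) = (\<Sum>i\<in>S. \<Sum>j\<in>F - S. q i j) + (\<Sum>j\<in>S. q x j)"
      using fin insert.hyps by (simp add: sum.distrib sym)
    thus ?thesis using tot split True S by (intro exI[of _ S]) auto
  next
    case False
    have "insert x F - insert x S = F - S" using insert.hyps by auto
    hence "(\<Sum>i\<in>insert x S. \<Sum>j\<in>insert x F - insert x S. q i j) =
       (\<Sum>i\<in>S. \<Sum>j\<in>F - S. q i j) + (\<Sum>j\<in>F - S. q x j)"
      using fin xS by simp
    thus ?thesis using tot split False S by (intro exI[of _ "insert x S"]) auto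
  qed
qed simp

text \<open>The supremum over \<theta> is at least the average over \<open>I\<close>, which the pair
  weights bound from below. After division by \<open>card I\<close> the diagonal has mass at most
  \<delta>, so distinct pairs keep \<open>1 - \<delta>\<close>, and the cut, counted in one order, a
  quarter of that. \<open>S\<close> is fixed before \<open>T\<close>, as the order of supremum and
  infimum requires.\<close>

lemma minimax_lower_bound:
  assumes \<sigma>: "\<sigma> > 0" and I: "finite I" "I \<noteq> {}" "\<And>\<theta>. \<theta> \<in> I \<Longrightarrow> \<theta> \<in> euc d \<and> vnorm d \<theta> \<le> 1"
    and \<delta>: "0 \<le> \<delta>" "(\<Sum>\<theta>\<in>I. exp (ip d \<theta> \<theta> / \<sigma>\<^sup>2)) \<le> (\<delta> * real (card I))\<^sup>2"
    and A: "0 \<le> A" "\<And>S. S \<subseteq> I \<Longrightarrow> \<exists>f\<in>F. \<forall>i\<in>S. \<forall>j\<in>I - S. A \<le> \<bar>f i - f j\<bar>"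
  shows "ennreal (A\<^sup>2 * (1 - \<delta>) / 4) \<le>
    (SUP f \<in> F. INF T \<in> estimators d. SUP \<theta> \<in> {\<theta> \<in> euc d. vnorm d \<theta> \<le> 1}. sq_risk d \<sigma> f T \<theta>)"
proof -
  define q where "q = pair_weight d \<sigma> I"
  have q: "q i j = q j i" "0 \<le> q i j" for i j
    unfolding q_def by (rule pair_weight_commute[OF \<sigma> I(1,2)], rule pair_weight_nonneg[OF \<sigma> I(1,2)])
  note q_sum = sum_pair_weight[OF \<sigma> I(1,2), of d, folded q_def]
  note q_diag = sum_pair_weight_diag_le[OF \<sigma> I(1,2), of d, folded q_def]
  obtain S where S: "S \<subseteq> I" "(\<Sum>i\<in>I. \<Sum>j\<in>I. q i j) - (\<Sum>i\<in>I. q i i) \<le> 4 * (\<Sum>i\<in>S. \<Sum>j\<in>I - S. q i j)"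
    using max_cut[OF I(1), of q] q by blast
  obtain f where f: "f \<in> F" "\<And>i j. i \<in> S \<Longrightarrow> j \<in> I - S \<Longrightarrow> A \<le> \<bar>f i - f j\<bar>"
    using A(2)[OF S(1)] by blast
  let ?N = "real (card I)"
  have N: "0 < ?N" using I by (simp add: card_gt_0_iff)
  have "sqrt (\<Sum>i\<in>I. exp (ip d i i / \<sigma>\<^sup>2)) \<le> \<delta> * ?N"
    using \<delta> N by (intro real_le_lsqrt) (auto intro: sum_nonneg)
  hence cut: "?N * (1 - \<delta>) / 4 \<le> (\<Sum>i\<in>S. \<Sum>j\<in>I - S. q i j)"
    using S(2) q_sum q_diag by (simp add: algebra_simps)
  define g where "g i j = (f i - f j)\<^sup>2 / 2 * q i j" for i j
  have g: "g i j = g j i" "0 \<le> g i j" for i j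
    using q(1)[of i j] q(2) by (simp_all add: g_def power2_commute)
  have fin: "finite S" "finite (I - S)" using S(1) I finite_subset by auto
  have "A\<^sup>2 * (?N * (1 - \<delta>) / 4) \<le> A\<^sup>2 * (\<Sum>i\<in>S. \<Sum>j\<in>I - S. q i j)"
    using cut by (intro mult_left_mono) auto
  also have "\<dots> = (\<Sum>i\<in>S. \<Sum>j\<in>I - S. A\<^sup>2 * q i j)" by (simp add: sum_distrib_left)
  also have "\<dots> \<le> (\<Sum>i\<in>S. \<Sum>j\<in>I - S. 2 * g i j)"
  proof (intro sum_mono)
    fix i j assume "i \<in> S" "j \<in> I - S"
    hence "A\<^sup>2 \<le> \<bar>f i - f j\<bar>\<^sup>2" using f(2) A(1) by (intro power_mono) auto
    hence "A\<^sup>2 * q i j \<le> (f i - f j)\<^sup>2 * q i j" using q(2) by (intro mult_right_mono) auto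
    thus "A\<^sup>2 * q i j \<le> 2 * g i j" by (simp add: g_def)
  qed
  \<comment> \<open>Counting the cut in both orders absorbs the 1/2 of the variance
    identity.\<close>
  also have "\<dots> = (\<Sum>i\<in>S. \<Sum>j\<in>I - S. g i j) + (\<Sum>i\<in>I - S. \<Sum>j\<in>S. g i j)"
  proof -
    have "(\<Sum>i\<in>I - S. \<Sum>j\<in>S. g i j) = (\<Sum>i\<in>S. \<Sum>j\<in>I - S. g i j)"
      by (subst sum.swap) (intro sum.cong refl g(1))
    thus ?thesis by (simp flip: sum_distrib_left)
  qed
  also have "\<dots> \<le> (\<Sum>i\<in>S. \<Sum>j\<in>I. g i j) + (\<Sum>i\<in>I - S. \<Sum>j\<in>I. g i j)"
    using S(1) I(1) g(2) by (intro add_mono sum_mono sum_mono2) auto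
  also have "\<dots> = (\<Sum>i\<in>I. \<Sum>j\<in>I. g i j)"
    using sum.subset_diff[OF S(1) I(1), of "\<lambda>i. \<Sum>j\<in>I. g i j"] by simp
  finally have *: "?N * (A\<^sup>2 * (1 - \<delta>) / 4) \<le> (\<Sum>i\<in>I. \<Sum>j\<in>I. g i j)" by (simp add: algebra_simps)
  show ?thesis
  proof (rule SUP_upper2[OF f(1)], rule INF_greatest)
    fix T assume T: "T \<in> estimators d"
    define R where "R = (SUP \<theta> \<in> {\<theta> \<in> euc d. vnorm d \<theta> \<le> 1}. sq_risk d \<sigma> f T \<theta>)"
    have "ennreal (?N * (A\<^sup>2 * (1 - \<delta>) / 4)) \<le> ennreal (\<Sum>i\<in>I. \<Sum>j\<in>I. g i j)"
      using * by (rule ennreal_leI)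
    also have "\<dots> \<le> (\<Sum>i\<in>I. sq_risk d \<sigma> f T i)" using sum_sq_risk_ge[OF \<sigma> I(1,2) T, of f] by (simp add: g_def q_def)
    also have "\<dots> \<le> of_nat (card I) * R"
      unfolding R_def by (rule sum_bounded_above, rule SUP_upper) (use I(3) in auto)
    finally have "ennreal ?N * ennreal (A\<^sup>2 * (1 - \<delta>) / 4) \<le> ennreal ?N * R"
      by (simp only: ennreal_mult'[OF of_nat_0_le_iff] ennreal_of_nat_eq_real_of_nat)
    thus "ennreal (A\<^sup>2 * (1 - \<delta>) / 4) \<le> (SUP \<theta> \<in> {\<theta> \<in> euc d. vnorm d \<theta> \<le> 1}. sq_risk d \<sigma> f T \<theta>)"
      using N unfolding R_def[symmetric] by (subst (asm) ennreal_mult_le_mult_iff) auto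
  qed
qed

section \<open>Operator norm and second moment of the noise\<close>

lemma vnorm_vzero: "vnorm d (vzero d) = 0"
  by (simp add: vnorm_eq_sqrt ip_vzero)

text \<open>An upper bound is the useful direction, since the norm stands on the smaller side of the
  final inequality.\<close>

lemma matrix_op_norm_cov_le: "matrix_op_norm d (cov_matrix \<sigma>) \<le> \<sigma>\<^sup>2"
  unfolding matrix_op_norm_def
proof (rule cSUP_least)
  have "vzero d \<in> {u \<in> euc d. vnorm d u \<le> 1}" by (simp add: vnorm_vzero)
  thus "{u \<in> euc d. vnorm d u \<le> 1} \<noteq> {}" by blast
  fix u assume u: "u \<in> {u \<in> euc d. vnorm d u \<le> 1}"
  have "(\<Sum>k<d. cov_matrix \<sigma> i k * u k) = \<sigma>\<^sup>2 * u i" if "i < d" for i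
  proof -
    have "(\<Sum>k<d. cov_matrix \<sigma> i k * u k) = (\<Sum>k<d. if i = k then \<sigma>\<^sup>2 * u k else 0)"
      by (intro sum.cong) (auto simp: cov_matrix_def)
    thus ?thesis using that by (simp add: sum.delta)
  qed
  hence "(\<lambda>i\<in>{..<d}. \<Sum>k<d. cov_matrix \<sigma> i k * u k) = vscale d (\<sigma>\<^sup>2) u"
    by (auto simp: vscale_def)
  thus "vnorm d (\<lambda>i\<in>{..<d}. \<Sum>k<d. cov_matrix \<sigma> i k * u k) \<le> \<sigma>\<^sup>2"
    using u by (simp add: vnorm_vscale mult_left_le)
qed

lemma noise_second_moment_eq:
  assumes \<sigma>: "\<sigma> > 0"
  shows "noise_second_moment d \<sigma> = \<sigma>\<^sup>2 * real d"
proof -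
  let ?N = "density lborel (\<lambda>x. ennreal (normal_density 0 \<sigma> x))"
  have gauss: "gaussian d (vzero d) \<sigma> = PiM {..<d} (\<lambda>_. ?N)"
    unfolding gaussian_def by (rule PiM_cong) (auto simp: vzero_def)
  have hb: "has_bochner_integral lborel (\<lambda>x. normal_density 0 \<sigma> x * x\<^sup>2) (\<sigma>\<^sup>2)"
    using normal_moment_even[OF \<sigma>, of 0 1] by (simp add: numeral_2_eq_2)
  have 1: "integrable ?N (\<lambda>x. x\<^sup>2)" "(\<integral>x. x\<^sup>2 \<partial>?N) = \<sigma>\<^sup>2"
    using hb by (auto simp: integrable_density integral_density has_bochner_integral_iff)
  have distr: "distr (PiM {..<d} (\<lambda>_. ?N)) ?N (\<lambda>x. x i) = ?N" if "i < d" for i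
    by (rule distr_PiM_component) (use that prob_space_normal_density[OF \<sigma>] in auto)
  have m: "(\<lambda>x. x i) \<in> PiM {..<d} (\<lambda>_. ?N) \<rightarrow>\<^sub>M ?N" if "i < d" for i
    by (rule measurable_component_singleton) (use that in auto)
  have 2: "integrable (PiM {..<d} (\<lambda>_. ?N)) (\<lambda>x. (x i)\<^sup>2)"
    "(\<integral>x. (x i)\<^sup>2 \<partial>PiM {..<d} (\<lambda>_. ?N)) = \<sigma>\<^sup>2" if i: "i < d" for i
    using 1 integrable_distr_eq[OF m[OF i], of "\<lambda>x. x\<^sup>2"] integral_distr[OF m[OF i], of "\<lambda>x. x\<^sup>2"]
    by (simp_all add: distr[OF i])
  have "noise_second_moment d \<sigma> = (\<integral>x. (\<Sum>i<d. (x i)\<^sup>2) \<partial>PiM {..<d} (\<lambda>_. ?N))"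
    unfolding noise_second_moment_def gauss vnorm_sq ip_def by (simp add: power2_eq_square)
  also have "\<dots> = (\<Sum>i<d. \<sigma>\<^sup>2)"
    by (subst Bochner_Integration.integral_sum) (auto simp: 2)
  finally show ?thesis by simp
qed

section \<open>Packings and the lower bounds\<close>

text \<open>The binomial theorem as a sum over subsets, used as a generating function for Hamming
  weights.\<close>

lemma sum_Pow_power_card:
  fixes x :: "'a :: comm_semiring_1"
  assumes "finite I"
  shows "(\<Sum>A\<in>Pow I. x ^ card A) = (1 + x) ^ card I"
  using assms
proof induction
  case (insert a F)
  have inj: "inj_on (insert a) (Pow F)" using insert.hyps by (auto simp: inj_on_def)
  have "(\<Sum>A\<in>insert a ` Pow F. x ^ card A) = (\<Sum>A\<in>Pow F. x ^ card (insert a A))"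
    by (simp add: sum.reindex[OF inj])
  also have "\<dots> = (\<Sum>A\<in>Pow F. x * x ^ card A)"
  proof (rule sum.cong[OF refl])
    fix A assume A: "A \<in> Pow F"
    hence "finite A" "a \<notin> A" using insert.hyps finite_subset by auto
    thus "x ^ card (insert a A) = x * x ^ card A" by simp
  qed
  finally have "(\<Sum>A\<in>Pow (insert a F). x ^ card A) = (\<Sum>A\<in>Pow F. x ^ card A) + x * (\<Sum>A\<in>Pow F. x ^ card A)"
    unfolding Pow_insert
    by (subst sum.union_disjoint) (use insert.hyps in \<open>auto simp: sum_distrib_left\<close>)
  thus ?case using insert by (simp add: algebra_simps)
qed simp

text \<open>A Chernoff bound: members of the ball have weight
  \<open>(6/5) ^ (d - 8 * card B) \<ge> 1\<close>, and the sum of these weights, extended to all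
  subsets, factorises. The base 6/5 yields the rate \<open>6/5 * (1 + (5/6)^8)\<close>, about 1.479
  and thus just below 3/2.\<close>

lemma card_hamming_ball_le: "real (card {B. B \<subseteq> {..<d} \<and> 8 * card B \<le> d}) \<le> (3 / 2) ^ d"
proof -
  have "real (card {B. B \<subseteq> {..<d} \<and> 8 * card B \<le> d}) = (\<Sum>B\<in>{B. B \<subseteq> {..<d} \<and> 8 * card B \<le> d}. 1)"
    by simp
  also have "\<dots> \<le> (\<Sum>B\<in>{B. B \<subseteq> {..<d} \<and> 8 * card B \<le> d}. (6 / 5) ^ d * ((5 / 6) ^ 8) ^ card B)"
  proof (rule sum_mono)
    fix B assume "B \<in> {B. B \<subseteq> {..<d} \<and> 8 * card B \<le> d}"
    hence "(6 / 5 :: real) ^ (8 * card B) \<le> (6 / 5) ^ d" by (intro power_increasing) auto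
    hence "(6 / 5 :: real) ^ (8 * card B) * (5 / 6) ^ (8 * card B) \<le> (6 / 5) ^ d * (5 / 6) ^ (8 * card B)"
      by (intro mult_right_mono) auto
    moreover have "(6 / 5 :: real) ^ (8 * card B) * (5 / 6) ^ (8 * card B) = 1"
      by (simp flip: power_mult_distrib)
    ultimately have "1 \<le> (6 / 5 :: real) ^ d * (5 / 6) ^ (8 * card B)" by linarith
    thus "1 \<le> (6 / 5 :: real) ^ d * ((5 / 6) ^ 8) ^ card B" by (simp only: power_mult)
  qed
  also have "\<dots> \<le> (\<Sum>B\<in>Pow {..<d}. (6 / 5) ^ d * ((5 / 6) ^ 8) ^ card B)"
    by (rule sum_mono2) auto
  also have "\<dots> = (6 / 5) ^ d * (1 + (5 / 6) ^ 8) ^ d"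
    by (simp only: sum_distrib_left[symmetric] sum_Pow_power_card[OF finite_lessThan] card_lessThan)
  also have "\<dots> = (6 / 5 * (1 + (5 / 6) ^ 8)) ^ d" by (simp only: power_mult_distrib)
  also have "\<dots> \<le> (3 / 2 :: real) ^ d" by (rule power_mono) (auto simp: power_divide)
  finally show ?thesis .
qed

text \<open>The Hamming balls of radius \<open>d / 8\<close> around a code of maximal size cover all
  subsets, since an uncovered one could be added. The rate 4/3 is the quotient of 2 and 3/2.\<close>

lemma gilbert_varshamov:
  obtains C where "C \<subseteq> Pow {..<d}"
    "\<And>A B. A \<in> C \<Longrightarrow> B \<in> C \<Longrightarrow> A \<noteq> B \<Longrightarrow> d \<le> 8 * card (sym_diff A B)"
    "(4 / 3) ^ d \<le> real (card C)"
proof -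
  define P where "P C \<longleftrightarrow> C \<subseteq> Pow {..<d} \<and> (\<forall>A\<in>C. \<forall>B\<in>C. A \<noteq> B \<longrightarrow> d \<le> 8 * card (sym_diff A B))" for C
  have "\<exists>C. P C \<and> (\<forall>C'. P C' \<longrightarrow> card C' \<le> card C)"
  proof (rule ex_has_greatest_nat[of P "{}" card "Suc (2 ^ d)"])
    show "P {}" by (simp add: P_def)
    show "\<forall>y. P y \<longrightarrow> card y < Suc (2 ^ d)"
      using card_mono[of "Pow {..<d}"] by (auto simp: P_def card_Pow less_Suc_eq_le)
  qed
  then obtain C where C: "P C" "\<And>C'. P C' \<Longrightarrow> card C' \<le> card C" by blast
  have fin: "finite C" using C(1) finite_subset by (auto simp: P_def)
  let ?ball = "{B. B \<subseteq> {..<d} \<and> 8 * card B \<le> d}"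
  have "Pow {..<d} \<subseteq> (\<Union>B\<in>C. sym_diff B ` ?ball)"
  proof
    fix A assume A: "A \<in> Pow {..<d}"
    have "\<exists>B\<in>C. 8 * card (sym_diff B A) \<le> d"
    proof (rule ccontr)
      assume "\<not> ?thesis"
      hence far: "\<And>B. B \<in> C \<Longrightarrow> d < 8 * card (sym_diff B A)" by force
      have "A \<notin> C" using far[of A] by auto
      have "P (insert A C)"
        unfolding P_def
      proof (intro conjI ballI impI)
        show "insert A C \<subseteq> Pow {..<d}" using C(1) A by (auto simp: P_def)
        fix B B' assume B: "B \<in> insert A C" "B' \<in> insert A C" "B \<noteq> B'"
        then consider "B \<in> C" "B' \<in> C" | "B \<in> C" "B' = A" | "B = A" "B' \<in> C" by auto
        thus "d \<le> 8 * card (sym_diff B B')"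
        proof cases
          case 1 thus ?thesis using C(1) B(3) by (auto simp: P_def)
        next
          case 2 thus ?thesis using far[of B] by simp
        next
          case 3 thus ?thesis using far[of B'] by (simp add: Un_commute)
        qed
      qed
      from C(2)[OF this] \<open>A \<notin> C\<close> fin show False by simp
    qed
    then obtain B where B: "B \<in> C" "8 * card (sym_diff B A) \<le> d" by blast
    have "sym_diff B A \<in> ?ball" using B C(1) A by (auto simp: P_def)
    \<comment> \<open>Translation by \<open>B\<close> is an involution, so the ball around
      \<open>B\<close> is the translate of the ball around the empty set.\<close>
    moreover have "A = sym_diff B (sym_diff B A)" by auto
    ultimately show "A \<in> (\<Union>B\<in>C. sym_diff B ` ?ball)" using B(1) by blast
  qed
  hence "card (Pow {..<d}) \<le> card (\<Union>B\<in>C. sym_diff B ` ?ball)"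
    by (intro card_mono) (use fin in auto)
  also have "\<dots> \<le> (\<Sum>B\<in>C. card (sym_diff B ` ?ball))" by (rule card_UN_le[OF fin])
  also have "\<dots> \<le> (\<Sum>B\<in>C. card ?ball)" by (intro sum_mono card_image_le) auto
  finally have "2 ^ d \<le> card C * card ?ball" by (simp add: card_Pow)
  hence "(2::real) ^ d \<le> real (card C) * real (card ?ball)"
    by (metis of_nat_le_iff of_nat_mult of_nat_numeral of_nat_power)
  also have "\<dots> \<le> real (card C) * (3 / 2) ^ d"
    by (intro mult_left_mono card_hamming_ball_le) auto
  finally have "(4 / 3 * (3 / 2) :: real) ^ d \<le> real (card C) * (3 / 2) ^ d" by simp
  hence "(4 / 3 :: real) ^ d \<le> real (card C)" unfolding power_mult_distrib by simp
  with C(1) show ?thesis unfolding P_def by (intro that[of C]) simp_all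
qed

section \<open>Values of a bump sum on and off its centres\<close>

lemma bump_sum_eq_0:
  assumes "0 < e" "0 < K" "\<And>\<theta>. \<theta> \<in> S \<Longrightarrow> e \<le> vnorm d (vdiff d x \<theta>)"
  shows "bump_sum d K A e S x = 0"
proof -
  have "max 0 (1 - (vnorm d (vdiff d x \<theta>) / e)\<^sup>2) = 0" if "\<theta> \<in> S" for \<theta>
  proof -
    have "1 \<le> vnorm d (vdiff d x \<theta>) / e" using assms(1,3) that by simp
    hence "1 \<le> (vnorm d (vdiff d x \<theta>) / e)\<^sup>2" by (rule one_le_power)
    thus ?thesis by simp
  qed
  thus ?thesis using assms(2) by (simp add: bump_sum_def)
qed

lemma vnorm_vdiff_self: "vnorm d (vdiff d x x) = 0"
  by (simp add: vnorm_eq_sqrt ip_def vdiff_def)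

lemma bump_sum_at_center:
  assumes e: "0 < e" "0 < K" and S: "finite S" "separated d (2 * e) S" "\<theta> \<in> S"
  shows "bump_sum d K A e S \<theta> = A"
proof -
  have "bump_sum d K A e S \<theta> = bump_sum d K A e {\<theta>} \<theta> + bump_sum d K A e (S - {\<theta>}) \<theta>"
    unfolding bump_sum_def using S by (simp add: sum.remove[of S \<theta>] algebra_simps)
  also have "bump_sum d K A e (S - {\<theta>}) \<theta> = 0"
  proof (rule bump_sum_eq_0[OF e])
    fix \<theta>' assume "\<theta>' \<in> S - {\<theta>}"
    hence "2 * e \<le> vnorm d (vdiff d \<theta> \<theta>')" using S(2,3) by (auto simp: separated_def)
    thus "e \<le> vnorm d (vdiff d \<theta> \<theta>')" using e by linarith
  qed
  finally show ?thesis by (simp add: bump_sum_def vnorm_vdiff_self)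
qed

text \<open>1.08 is \<open>81/100 * 4/3\<close>: the divergence grows with \<open>d\<close> at a
  smaller rate than the code, with \<open>(9/10)^2\<close> to spare.\<close>

lemma exp_sixteenth_le: "exp (1 / 16 :: real) \<le> 1.08"
  using exp_bound[of "1 / 16"] by (simp add: power2_eq_square)

abbreviation (input) minimax_risk :: "real \<Rightarrow> nat \<Rightarrow> real \<Rightarrow> ennreal" where
  "minimax_risk s d \<sigma> \<equiv>
     (SUP f \<in> Cs_ball d s. INF T \<in> estimators d. SUP \<theta> \<in> {\<theta> \<in> euc d. vnorm d \<theta> \<le> 1}. sq_risk d \<sigma> f T \<theta>)"

section \<open>The lower bound from a code in a cube\<close>

definition cube_pnt :: "nat \<Rightarrow> real \<Rightarrow> nat set \<Rightarrow> pnt" where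
  "cube_pnt d r A = (\<lambda>i\<in>{..<d}. if i \<in> A then r else 0)"

lemma cube_pnt_in_euc [simp]: "cube_pnt d r A \<in> euc d"
  by (simp add: euc_def cube_pnt_def PiE_iff)

lemma ip_cube_pnt: "A \<subseteq> {..<d} \<Longrightarrow> ip d (cube_pnt d r A) (cube_pnt d r A) = r\<^sup>2 * real (card A)"
proof -
  assume A: "A \<subseteq> {..<d}"
  have "ip d (cube_pnt d r A) (cube_pnt d r A) = (\<Sum>i<d. if i \<in> A then r\<^sup>2 else 0)"
    unfolding ip_def by (intro sum.cong) (auto simp: cube_pnt_def power2_eq_square)
  also have "\<dots> = (\<Sum>i\<in>A. r\<^sup>2)"
    using A by (simp add: sum.If_cases Int_absorb1)
  finally show ?thesis by simp
qed

lemma vnorm_vdiff_cube_pnt: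
  assumes "A \<subseteq> {..<d}" "B \<subseteq> {..<d}" "0 \<le> r"
  shows "vnorm d (vdiff d (cube_pnt d r A) (cube_pnt d r B)) = r * sqrt (real (card (sym_diff A B)))"
proof -
  have "ip d (vdiff d (cube_pnt d r A) (cube_pnt d r B)) (vdiff d (cube_pnt d r A) (cube_pnt d r B)) =
      ip d (cube_pnt d r (sym_diff A B)) (cube_pnt d r (sym_diff A B))"
    unfolding ip_def by (intro sum.cong) (auto simp: cube_pnt_def vdiff_def)
  also have "\<dots> = r\<^sup>2 * real (card (sym_diff A B))"
    by (rule ip_cube_pnt) (use assms in auto)
  finally show ?thesis using assms(3) by (simp add: vnorm_eq_sqrt real_sqrt_mult)
qed

text \<open>The side \<open>r\<close> obeys two limits: \<open>\<sigma> / 4\<close> keeps the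
  squared signal-to-noise ratio at most \<open>d / 16\<close>, which the size of the code can pay
  for, and \<open>1 / (4 * sqrt d)\<close> keeps the cube in the unit ball.\<close>

lemma minimax_risk_ge_dimension:
  assumes s: "s > 0"
  shows "\<exists>c>0. \<forall>d \<sigma>. 1 \<le> d \<longrightarrow> 0 < \<sigma> \<longrightarrow>
    ennreal (c * min ((\<sigma>\<^sup>2 * real d) powr s) 1) \<le> minimax_risk s d \<sigma>"
proof -
  define K where "K = nat \<lfloor>s\<rfloor> + 2"
  obtain a where a: "0 < a" "\<And>d e S. 0 < e \<Longrightarrow> e \<le> 1 \<Longrightarrow> finite S \<Longrightarrow> separated d (2 * e) S \<Longrightarrow>
      bump_sum d K (a * e powr s) e S \<in> Cs_ball d s"
    using bump_sum_in_Cs_ball[OF s] unfolding K_def by blast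
  show ?thesis
  \<comment> \<open>40 is \<open>4 / (1 - 9/10)\<close>; 576 is \<open>(4 * 6)^2\<close>, from the
    divisors in \<open>r\<close> and \<open>e\<close>.\<close>
  proof (intro exI[of _ "a\<^sup>2 / (40 * 576 powr s)"] conjI allI impI)
    show "0 < a\<^sup>2 / (40 * 576 powr s)" using a by simp
    fix d :: nat and \<sigma> :: real assume d: "1 \<le> d" and \<sigma>: "0 < \<sigma>"
    define r where "r = min \<sigma> (1 / sqrt (real d)) / 4"
    \<comment> \<open>Code points are at least \<open>r * sqrt (d / 8)\<close> apart; weakening 8 to
      9 gives the rational multiple \<open>r * sqrt d / 3 = 2 * e\<close>.\<close>
    define e where "e = r * sqrt (real d) / 6"
    have r: "0 < r" "r \<le> \<sigma> / 4" "r \<le> 1 / sqrt (real d) / 4" using d \<sigma> by (auto simp: r_def)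
    have rd: "r * sqrt (real d) \<le> 1" using r(3) d by (simp add: field_simps)
    have e: "0 < e" "e \<le> 1" using r d rd by (auto simp: e_def)
    have r2: "r\<^sup>2 * 16 = min (\<sigma>\<^sup>2) (1 / real d)"
    proof (cases "\<sigma> \<le> 1 / sqrt (real d)")
      case True
      hence "\<sigma>\<^sup>2 \<le> (1 / sqrt (real d))\<^sup>2" using \<sigma> by (intro power_mono) auto
      thus ?thesis using True by (simp add: r_def power_divide)
    next
      case False
      hence "(1 / sqrt (real d))\<^sup>2 \<le> \<sigma>\<^sup>2" by (intro power_mono) auto
      thus ?thesis using False by (simp add: r_def power_divide)
    qed
    obtain C where C: "C \<subseteq> Pow {..<d}" "\<And>A B. A \<in> C \<Longrightarrow> B \<in> C \<Longrightarrow> A \<noteq> B \<Longrightarrow> d \<le> 8 * card (sym_diff A B)"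
      "(4 / 3) ^ d \<le> real (card C)"
      by (rule gilbert_varshamov[of d]) (rule that)
    have finC: "finite C" using C(1) finite_subset by auto
    have dist: "2 * e \<le> vnorm d (vdiff d (cube_pnt d r A) (cube_pnt d r B))"
      if AB: "A \<in> C" "B \<in> C" "A \<noteq> B" for A B
    proof -
      have "real d / 9 \<le> real (card (sym_diff A B))" using C(2)[OF AB] by linarith
      hence "sqrt (real d / 9) \<le> sqrt (real (card (sym_diff A B)))" by (rule real_sqrt_le_mono)
      hence "r * (sqrt (real d) / 3) \<le> r * sqrt (real (card (sym_diff A B)))"
        using r by (intro mult_left_mono) (auto simp: real_sqrt_divide)
      moreover have "vnorm d (vdiff d (cube_pnt d r A) (cube_pnt d r B)) = r * sqrt (real (card (sym_diff A B)))"
        by (rule vnorm_vdiff_cube_pnt) (use AB C(1) r in auto)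
      ultimately show ?thesis by (simp add: e_def)
    qed
    define I where "I = cube_pnt d r ` C"
    have inj: "inj_on (cube_pnt d r) C"
    proof (rule inj_onI, rule ccontr)
      fix A B assume "A \<in> C" "B \<in> C" "cube_pnt d r A = cube_pnt d r B" "A \<noteq> B"
      thus False using dist[of A B] e by (simp add: vnorm_vdiff_self)
    qed
    have cardI: "card I = card C" unfolding I_def by (rule card_image[OF inj])
    have sep: "separated d (2 * e) I" using dist by (auto simp: separated_def I_def)
    have ipI: "ip d \<theta> \<theta> \<le> r\<^sup>2 * real d" if "\<theta> \<in> I" for \<theta>
    proof -
      obtain A where A: "A \<in> C" "\<theta> = cube_pnt d r A" using \<open>\<theta> \<in> I\<close> by (auto simp: I_def)
      have "A \<subseteq> {..<d}" using A C(1) by auto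
      moreover from card_mono[OF _ this] have "card A \<le> d" by simp
      ultimately show ?thesis by (simp add: A ip_cube_pnt mult_left_mono)
    qed
    have "exp (real d / 16) = exp (1 / 16) ^ d" by (simp flip: exp_of_nat_mult)
    also have "\<dots> \<le> 1.08 ^ d" by (rule power_mono[OF exp_sixteenth_le]) simp
    also have "\<dots> = (81 / 100) ^ d * (4 / 3) ^ d" by (simp flip: power_mult_distrib)
    \<comment> \<open>One factor 81/100 survives because \<open>d \<ge> 1\<close>; its square root
      is the \<delta> of the Bayes bound.\<close>
    also have "\<dots> \<le> (81 / 100) ^ 1 * (4 / 3) ^ d"
      using d by (intro mult_right_mono power_decreasing) auto
    also have "\<dots> \<le> (81 / 100) * real (card C)" using C(3) by simp
    finally have expN: "exp (real d / 16) \<le> (81 / 100) * real (card C)" .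
    have bound: "ennreal ((a * e powr s)\<^sup>2 * (1 - 9 / 10) / 4) \<le> minimax_risk s d \<sigma>"
    proof (rule minimax_lower_bound[OF \<sigma>, of I])
      show "finite I" using finC by (simp add: I_def)
      have "0 < real (card C)" using C(3) by (rule less_le_trans[rotated]) simp
      thus "I \<noteq> {}" by (auto simp: I_def)
      fix \<theta> assume "\<theta> \<in> I"
      moreover have "sqrt (ip d \<theta> \<theta>) \<le> r * sqrt (real d)"
        using real_sqrt_le_mono[OF ipI[OF \<open>\<theta> \<in> I\<close>]] r by (simp add: real_sqrt_mult)
      hence "vnorm d \<theta> \<le> 1" unfolding vnorm_eq_sqrt using rd by linarith
      ultimately show "\<theta> \<in> euc d \<and> vnorm d \<theta> \<le> 1" by (auto simp: I_def)
    next
      have "(\<Sum>\<theta>\<in>I. exp (ip d \<theta> \<theta> / \<sigma>\<^sup>2)) \<le> real (card I) * exp (real d / 16)"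
      proof (rule sum_bounded_above)
        fix \<theta> assume "\<theta> \<in> I"
        have "r\<^sup>2 \<le> \<sigma>\<^sup>2 / 16" using r2 by simp
        hence "r\<^sup>2 * real d \<le> \<sigma>\<^sup>2 / 16 * real d" by (rule mult_right_mono) simp
        hence "ip d \<theta> \<theta> \<le> \<sigma>\<^sup>2 / 16 * real d" using ipI[OF \<open>\<theta> \<in> I\<close>] by linarith
        thus "exp (ip d \<theta> \<theta> / \<sigma>\<^sup>2) \<le> exp (real d / 16)" using \<sigma> by (simp add: field_simps)
      qed
      also have "\<dots> \<le> real (card I) * ((81 / 100) * real (card C))"
        by (intro mult_left_mono expN) simp
      finally show "(\<Sum>\<theta>\<in>I. exp (ip d \<theta> \<theta> / \<sigma>\<^sup>2)) \<le> (9 / 10 * real (card I))\<^sup>2"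
        by (simp add: cardI power2_eq_square)
    next
      fix S assume S: "S \<subseteq> I"
      have finS: "finite S" using S finC finite_subset by (auto simp: I_def)
      have sepS: "separated d (2 * e) S" using sep S by (auto simp: separated_def)
      let ?f = "bump_sum d K (a * e powr s) e S"
      have "a * e powr s \<le> \<bar>?f i - ?f j\<bar>" if ij: "i \<in> S" "j \<in> I - S" for i j
      proof -
        have "?f i = a * e powr s"
          by (rule bump_sum_at_center[OF e(1) _ finS sepS ij(1)]) (simp add: K_def)
        moreover have "?f j = 0"
        proof (rule bump_sum_eq_0[OF e(1)])
          fix \<theta> assume "\<theta> \<in> S"
          hence "\<theta> \<in> I" "j \<in> I" "j \<noteq> \<theta>" using S ij by auto
          hence "2 * e \<le> vnorm d (vdiff d j \<theta>)" using sep unfolding separated_def by blast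
          thus "e \<le> vnorm d (vdiff d j \<theta>)" using e by linarith
        qed (simp add: K_def)
        ultimately show ?thesis by simp
      qed
      thus "\<exists>f\<in>Cs_ball d s. \<forall>i\<in>S. \<forall>j\<in>I - S. a * e powr s \<le> \<bar>f i - f j\<bar>"
        using a(2)[OF e finS sepS] by blast
    qed (use a in auto)
    have e2: "e\<^sup>2 = min (\<sigma>\<^sup>2 * real d) 1 / 576"
    proof -
      have "e\<^sup>2 = r\<^sup>2 * 16 * real d / 576" by (simp add: e_def power_mult_distrib power_divide)
      also have "r\<^sup>2 * 16 * real d = min (\<sigma>\<^sup>2 * real d) 1"
        unfolding r2 using d by (simp add: min_mult_distrib_right)
      finally show ?thesis .
    qed
    have "(e powr s)\<^sup>2 = (e\<^sup>2) powr s"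
      using e by (simp add: power2_eq_square powr_mult)
    also have "\<dots> = (min (\<sigma>\<^sup>2 * real d) 1 / 576) powr s" by (simp only: e2)
    also have "\<dots> = min (\<sigma>\<^sup>2 * real d) 1 powr s / 576 powr s"
      by (simp add: powr_divide)
    also have "min (\<sigma>\<^sup>2 * real d) 1 powr s = min ((\<sigma>\<^sup>2 * real d) powr s) 1"
    proof (cases "\<sigma>\<^sup>2 * real d \<le> 1")
      case True
      thus ?thesis using powr_le1[of s "\<sigma>\<^sup>2 * real d"] s by (simp add: min_def)
    next
      case False
      thus ?thesis using ge_one_powr_ge_zero[of "\<sigma>\<^sup>2 * real d" s] s by (simp add: min_def)
    qed
    finally have eq: "(a * e powr s)\<^sup>2 * (1 - 9 / 10) / 4 = a\<^sup>2 / (40 * 576 powr s) * min ((\<sigma>\<^sup>2 * real d) powr s) 1"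
      by (simp add: power_mult_distrib)
    show "ennreal (a\<^sup>2 / (40 * 576 powr s) * min ((\<sigma>\<^sup>2 * real d) powr s) 1) \<le> minimax_risk s d \<sigma>"
      by (rule bound[unfolded eq])
  qed
qed

section \<open>The lower bound from two points on one bump\<close>

definition axis_pnt :: "nat \<Rightarrow> real \<Rightarrow> pnt" where
  "axis_pnt d t = (\<lambda>i\<in>{..<d}. if i = 0 then t else 0)"

lemma axis_pnt_in_euc [simp]: "axis_pnt d t \<in> euc d"
  by (simp add: euc_def axis_pnt_def PiE_iff)

lemma ip_axis_pnt: "1 \<le> d \<Longrightarrow> ip d (axis_pnt d t) (axis_pnt d t) = t\<^sup>2"
proof -
  assume d: "1 \<le> d"
  have "ip d (axis_pnt d t) (axis_pnt d t) = (\<Sum>i<d. if i = 0 then t\<^sup>2 else 0)"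
    unfolding ip_def by (intro sum.cong) (auto simp: axis_pnt_def power2_eq_square)
  thus ?thesis using d by (simp add: sum.delta)
qed

lemma vnorm_axis_pnt: "1 \<le> d \<Longrightarrow> vnorm d (axis_pnt d t) = \<bar>t\<bar>"
  by (simp add: vnorm_eq_sqrt ip_axis_pnt)

lemma vdiff_axis_pnt: "vdiff d (axis_pnt d t) (axis_pnt d u) = axis_pnt d (t - u)"
  by (auto simp: vdiff_def axis_pnt_def)

text \<open>A bump of fixed radius 1 has slope of order 1 on its flank, so parameters at a distance
  of order \<open>min \<sigma> 1\<close> have values that differ by the same order, whatever
  \<open>s\<close> is. The centre at -1/2 puts the origin on the flank, away from the flat
  top.\<close>

lemma minimax_risk_ge_variance:
  assumes s: "s > 0"
  shows "\<exists>c>0. \<forall>d \<sigma>. 1 \<le> d \<longrightarrow> 0 < \<sigma> \<longrightarrow> ennreal (c * min (\<sigma>\<^sup>2) 1) \<le> minimax_risk s d \<sigma>"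
proof -
  define K where "K = Suc (Suc (nat \<lfloor>s\<rfloor>))"
  obtain a where a: "0 < a" "\<And>d e S. 0 < e \<Longrightarrow> e \<le> 1 \<Longrightarrow> finite S \<Longrightarrow> separated d (2 * e) S \<Longrightarrow>
      bump_sum d K (a * e powr s) e S \<in> Cs_ball d s"
    using bump_sum_in_Cs_ball[OF s] unfolding K_def by auto
  \<comment> \<open>A lower bound for the slope: 3/4 is the base \<open>1 - (1/2)^2\<close> at the
    origin; \<open>K - 1\<close> factors of the smaller base at \<eta> are replaced by it, and one
    is left to compare.\<close>
  define b where "b = a * (3 / 4) ^ (K - 1)"
  have b: "0 < b" using a by (simp add: b_def)
  show ?thesis
  proof (intro exI[of _ "b\<^sup>2 / 256"] conjI allI impI)
    show "0 < b\<^sup>2 / 256" using b by simp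
    fix d :: nat and \<sigma> :: real assume d: "1 \<le> d" and \<sigma>: "0 < \<sigma>"
    define \<eta> where "\<eta> = min \<sigma> 1 / 4"
    have \<eta>: "0 < \<eta>" "\<eta> \<le> 1 / 4" "\<eta> \<le> \<sigma> / 4" using \<sigma> by (auto simp: \<eta>_def)
    define f where "f = bump_sum d K a 1 {axis_pnt d (- 1 / 2)}"
    have f: "f \<in> Cs_ball d s"
      using a(2)[of 1 "{axis_pnt d (- 1 / 2)}" d] by (simp add: separated_def f_def)
    have f_axis: "f (axis_pnt d t) = a * max 0 (1 - (t + 1 / 2)\<^sup>2) ^ K" for t
      by (simp add: f_def bump_sum_def vdiff_axis_pnt vnorm_axis_pnt[OF d])
    have "b * \<eta> \<le> f (axis_pnt d 0) - f (axis_pnt d \<eta>)"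
    proof -
      define B where "B = 3 / 4 - \<eta> - \<eta>\<^sup>2"
      have \<eta>2: "\<eta>\<^sup>2 \<le> 1 / 16" using power_mono[of \<eta> "1 / 4" 2] \<eta> by (simp add: power_divide)
      have B: "0 \<le> B" "B \<le> 3 / 4" "\<eta> \<le> 3 / 4 - B"
        using \<eta> \<eta>2 zero_le_power2[of \<eta>] unfolding B_def by linarith+
      have "1 - (\<eta> + 1 / 2)\<^sup>2 = B" by (simp add: B_def power2_eq_square algebra_simps)
      hence 1: "f (axis_pnt d \<eta>) = a * B ^ K" using B by (simp add: f_axis)
      have 0: "f (axis_pnt d 0) = a * (3 / 4) ^ K" by (simp add: f_axis power_divide)
      have "B ^ K \<le> B * (3 / 4) ^ (K - 1)"
        using mult_left_mono[OF power_mono[OF B(2,1), of "K - 1"] B(1)] by (simp add: K_def)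
      moreover have "(3 / 4 :: real) ^ K = (3 / 4) * (3 / 4) ^ (K - 1)" by (simp add: K_def)
      ultimately have "(3 / 4 - B) * (3 / 4) ^ (K - 1) \<le> (3 / 4) ^ K - B ^ K" by (simp add: algebra_simps)
      hence "\<eta> * (3 / 4) ^ (K - 1) \<le> (3 / 4) ^ K - B ^ K"
        using B(3) by (elim order_trans[rotated]) (intro mult_right_mono, auto)
      hence "a * (\<eta> * (3 / 4) ^ (K - 1)) \<le> a * ((3 / 4) ^ K - B ^ K)"
        using a(1) by (intro mult_left_mono) auto
      thus ?thesis by (simp add: 0 1 b_def algebra_simps)
    qed
    hence sepf: "b * \<eta> \<le> \<bar>f (axis_pnt d 0) - f (axis_pnt d \<eta>)\<bar>"
      "b * \<eta> \<le> \<bar>f (axis_pnt d \<eta>) - f (axis_pnt d 0)\<bar>" by linarith+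
    have neq: "axis_pnt d 0 \<noteq> axis_pnt d \<eta>"
      using vnorm_axis_pnt[OF d, of 0] vnorm_axis_pnt[OF d, of \<eta>] \<eta> by auto
    have bound: "ennreal ((b * \<eta>)\<^sup>2 * (1 - 3 / 4) / 4) \<le> minimax_risk s d \<sigma>"
    proof (rule minimax_lower_bound[OF \<sigma>, of "{axis_pnt d 0, axis_pnt d \<eta>}"])
      have "\<eta>\<^sup>2 \<le> (\<sigma> / 4)\<^sup>2" using \<eta> by (intro power_mono) auto
      hence "\<eta>\<^sup>2 / \<sigma>\<^sup>2 \<le> 1 / 16" using \<sigma> by (simp add: field_simps)
      hence "exp (\<eta>\<^sup>2 / \<sigma>\<^sup>2) \<le> 1.08" using exp_sixteenth_le by (meson exp_le_cancel_iff order_trans)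
      \<comment> \<open>The sum is at most \<open>1 + 1.08 = 2.08\<close>, below
        \<open>(3/4 * 2)^2 = 2.25\<close>.\<close>
      thus "(\<Sum>\<theta>\<in>{axis_pnt d 0, axis_pnt d \<eta>}. exp (ip d \<theta> \<theta> / \<sigma>\<^sup>2))
          \<le> (3 / 4 * real (card {axis_pnt d 0, axis_pnt d \<eta>}))\<^sup>2"
        using neq by (simp add: ip_axis_pnt[OF d] power2_eq_square)
    next
      fix S assume "S \<subseteq> {axis_pnt d 0, axis_pnt d \<eta>}"
      \<comment> \<open>A single \<open>f\<close> serves every \<open>S\<close>: only the two
        singletons leave a pair to separate.\<close>
      thus "\<exists>f\<in>Cs_ball d s. \<forall>i\<in>S. \<forall>j\<in>{axis_pnt d 0, axis_pnt d \<eta>} - S. b * \<eta> \<le> \<bar>f i - f j\<bar>"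
        using sepf f by (intro bexI[of _ f]) auto
    next
      fix \<theta> assume "\<theta> \<in> {axis_pnt d 0, axis_pnt d \<eta>}"
      thus "\<theta> \<in> euc d \<and> vnorm d \<theta> \<le> 1"
        using \<eta> by (auto simp: vnorm_axis_pnt[OF d])
    qed (use b \<eta> in auto)
    have "16 * \<eta>\<^sup>2 = min (\<sigma>\<^sup>2) 1"
    proof (cases "\<sigma> \<le> 1")
      case True
      thus ?thesis using power_le_one[of \<sigma> 2] \<sigma> by (simp add: \<eta>_def power_divide)
    next
      case False
      thus ?thesis using one_le_power[of \<sigma> 2] by (simp add: \<eta>_def power_divide)
    qed
    hence eq: "(b * \<eta>)\<^sup>2 * (1 - 3 / 4) / 4 = b\<^sup>2 / 256 * min (\<sigma>\<^sup>2) 1"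
      by (simp add: power_mult_distrib flip: \<open>16 * \<eta>\<^sup>2 = min (\<sigma>\<^sup>2) 1\<close>)
    show "ennreal (b\<^sup>2 / 256 * min (\<sigma>\<^sup>2) 1) \<le> minimax_risk s d \<sigma>" by (rule bound[unfolded eq])
  qed
qed

text \<open>The larger of the two terms selects which lower bound is applied; the constant depends
  on \<open>s\<close> alone.\<close>

theorem theorem2p2:
  fixes s :: real
  assumes "s > 0"
  shows "\<exists>c::real. c > 0 \<and> (\<forall>(d::nat) (\<sigma>::real). d \<ge> 1 \<longrightarrow> \<sigma> > 0 \<longrightarrow>
           (SUP f \<in> Cs_ball d s. INF T \<in> estimators d. SUP \<theta> \<in> {\<theta> \<in> euc d. vnorm d \<theta> \<le> 1}.
              sq_risk d \<sigma> f T \<theta>)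
           \<ge> ennreal (c * min (max (matrix_op_norm d (cov_matrix \<sigma>))
                                   (noise_second_moment d \<sigma> powr s)) 1))"
proof -
  obtain c1 where c1: "c1 > 0" "\<And>d \<sigma>. 1 \<le> d \<Longrightarrow> 0 < \<sigma> \<Longrightarrow>
      ennreal (c1 * min ((\<sigma>\<^sup>2 * real d) powr s) 1) \<le> minimax_risk s d \<sigma>"
    using minimax_risk_ge_dimension[OF assms] by auto
  obtain c2 where c2: "c2 > 0" "\<And>d \<sigma>. 1 \<le> d \<Longrightarrow> 0 < \<sigma> \<Longrightarrow>
      ennreal (c2 * min (\<sigma>\<^sup>2) 1) \<le> minimax_risk s d \<sigma>"
    using minimax_risk_ge_variance[OF assms] by auto
  show ?thesis
  proof (intro exI[of _ "min c1 c2"] conjI allI impI)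
    show "min c1 c2 > 0" using c1 c2 by simp
    fix d :: nat and \<sigma> :: real assume d: "d \<ge> 1" and \<sigma>: "\<sigma> > 0"
    let ?x = "matrix_op_norm d (cov_matrix \<sigma>)" and ?y = "noise_second_moment d \<sigma> powr s"
    have y: "?y = (\<sigma>\<^sup>2 * real d) powr s" by (simp add: noise_second_moment_eq[OF \<sigma>])
    show "ennreal (min c1 c2 * min (max ?x ?y) 1) \<le> minimax_risk s d \<sigma>"
    proof (cases "?x \<le> ?y")
      case True
      hence "min c1 c2 * min (max ?x ?y) 1 \<le> c1 * min ((\<sigma>\<^sup>2 * real d) powr s) 1"
        using c1(1) c2(1) unfolding y by (intro mult_mono) (auto simp: max_def)
      thus ?thesis using c1(2)[OF d \<sigma>] by (meson ennreal_leI order_trans)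
    next
      case False
      have "min (max ?x ?y) 1 \<le> min (\<sigma>\<^sup>2) 1"
        using False matrix_op_norm_cov_le[of d \<sigma>] by (auto simp: max_def)
      moreover have "0 \<le> min (max ?x ?y) 1" by (auto simp: max_def intro: order_trans[of 0 ?y])
      ultimately have "min c1 c2 * min (max ?x ?y) 1 \<le> c2 * min (\<sigma>\<^sup>2) 1"
        using c1(1) c2(1) by (intro mult_mono) auto
      thus ?thesis using c2(2)[OF d \<sigma>] by (meson ennreal_leI order_trans)
    qed
  qed
qed

end
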